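(* Assume $g(\partial\Omega)=[0,1]$. For $j=1,2$, let $F_j\in C^2(\mathbb{R})$ be non-increasing with $F_j(0)=0$ and of the form $$F_j(s)=b_j s^{\ell_j}h(s),\quad s\in\mathbb{R},$$ where $h\in C^2(\mathbb{R})$ has no zero on $[0,1]$, $\ell_j\in\mathbb{N}$, $b_j\in\mathbb{R}$, and $$\min(|b_1|,|b_2|)=m>0,\qquad \max(|b_1|,|b_2|)=M.$$ For $\delta\in[0,1]$ let $u_{j,\delta}\in C^{2+\alpha}(\overline{\Omega})$ be the solution of $$-|a|^{\frac12}\sum_{i,k=1}^n \partial_{x_i}\left(|a|^{-\frac12}a_{i,k}\,\partial_{x_k}u_{j,\delta}\right)=F_j(u_{j,\delta})\ \text{in }\Omega,\qquad u_{j,\delta}=\delta g\ \text{on }\partial\Omega.$$ Let $x_0\in\partial\Omega$ be arbitrary. Then, for any $\delta\in(0,m/M)$, the condition $$\partial_{\nu_a}u_{1,\delta}(x_0)=\partial_{\nu_a}u_{2,\delta}(x_0)$$ implies that $F_1=F_2$.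
   Context: Let $n\ge2$, $\alpha\in(0,1)$, and let $\Omega\subset\mathbb{R}^n$ be a bounded connected domain with $C^{2+\alpha}$ boundary. Let $a=(a_{i,j})_{1\le i,j\le n}\in C^2(\overline{\Omega};\mathbb{R}^{n^2})$ be symmetric ($a_{i,j}=a_{j,i}$) and elliptic: there is $c>0$ with $\sum_{i,j}a_{i,j}(x)\xi_i\xi_j\ge c|\xi|^2$ for all $x\in\overline\Omega$, $\xi\in\mathbb{R}^n$. $|a|$ denotes the absolute value of the determinant of $a$. Let $g\in C^{2+\alpha}(\partial\Omega)$. For non-increasing $F\in C^1(\mathbb{R})$ with $F(0)=0$, the boundary value problem with source $F(u)$ and Dirichlet data $\delta g$ has a unique solution in $C^{2+\alpha}(\overline\Omega)$ for every $\delta\in[0,1]$. With $\nu$ the outward unit normal to $\partial\Omega$, $\partial_{\nu_a}v(x)=\sum_{i,j=1}^n a_{i,j}(x)\,\partial_{x_j}v(x)\,\nu_i(x)$ for $x\in\partial\Omega$. *)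

theory Defs
  imports "HOL-Analysis.Analysis"
begin

section \<open>Partial derivatives and function spaces up to the boundary\<close>

definition partial_deriv :: "'a::euclidean_space \<Rightarrow> ('a \<Rightarrow> real) \<Rightarrow> 'a \<Rightarrow> real" where
  "partial_deriv b u x = deriv (\<lambda>t. u (x + t *\<^sub>R b)) 0"

text \<open>
  \<open>C_upto k S\<close> is \<open>C\<^sup>k\<close> on the closure of the open set \<open>S\<close>: all partial derivatives of order at
  most \<open>k\<close> exist in \<open>S\<close> and extend continuously to the closure. The function \<open>v\<close> below is that
  extension; only values of \<open>u\<close> on \<open>closure S\<close> matter. For \<open>S = UNIV\<close> this is the usual
  \<open>C\<^sup>k\<close>, in particular \<open>C\<^sup>k(\<real>)\<close> for the type \<open>real\<close>, where \<open>Basis = {1}\<close>.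
\<close>

primrec C_upto :: "nat \<Rightarrow> 'a::euclidean_space set \<Rightarrow> ('a \<Rightarrow> real) \<Rightarrow> bool" where
  "C_upto 0 S u \<longleftrightarrow> continuous_on (closure S) u"
| "C_upto (Suc k) S u \<longleftrightarrow>
     continuous_on (closure S) u \<and> (\<forall>x\<in>S. u differentiable (at x)) \<and>
     (\<forall>b\<in>Basis. \<exists>v. (\<forall>x\<in>S. v x = partial_deriv b u x) \<and> C_upto k S v)"

definition Holder_on :: "real \<Rightarrow> 'a::euclidean_space set \<Rightarrow> ('a \<Rightarrow> real) \<Rightarrow> bool" where
  "Holder_on \<alpha> A u \<longleftrightarrow> (\<exists>C. \<forall>x\<in>A. \<forall>y\<in>A. \<bar>u x - u y\<bar> \<le> C * dist x y powr \<alpha>)"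

text \<open>
  \<open>C_Holder_upto k \<alpha> S\<close> is \<open>C\<^sup>k\<^sup>+\<^sup>\<alpha>\<close> on the closure of \<open>S\<close>, for \<open>0 < \<alpha> < 1\<close>: as above, and the
  derivatives of order \<open>k\<close> are uniformly Hoelder continuous with exponent \<open>\<alpha>\<close>.
\<close>

primrec C_Holder_upto ::
  "nat \<Rightarrow> real \<Rightarrow> 'a::euclidean_space set \<Rightarrow> ('a \<Rightarrow> real) \<Rightarrow> bool" where
  "C_Holder_upto 0 \<alpha> S u \<longleftrightarrow> continuous_on (closure S) u \<and> Holder_on \<alpha> (closure S) u"
| "C_Holder_upto (Suc k) \<alpha> S u \<longleftrightarrow>
     continuous_on (closure S) u \<and> (\<forall>x\<in>S. u differentiable (at x)) \<and>
     (\<forall>b\<in>Basis. \<exists>v. (\<forall>x\<in>S. v x = partial_deriv b u x) \<and> C_Holder_upto k \<alpha> S v)"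


section \<open>Domains with regular boundary\<close>

text \<open>
  Near \<open>x0\<close>, \<open>S\<close> is the region above the graph of a \<open>C\<^sup>k\<^sup>+\<^sup>\<alpha>\<close> function of the \<open>n - 1\<close> coordinates
  orthogonal to the unit vector \<open>e\<close>. Such a function is represented by a function \<open>\<gamma>\<close> on the
  whole space that is constant in direction \<open>e\<close>.
\<close>

definition graph_chart ::
  "nat \<Rightarrow> real \<Rightarrow> 'a::euclidean_space set \<Rightarrow> 'a \<Rightarrow> real \<Rightarrow> 'a \<Rightarrow> ('a \<Rightarrow> real) \<Rightarrow> bool" where
  "graph_chart k \<alpha> S x0 r e \<gamma> \<longleftrightarrow>
     r > 0 \<and> norm e = 1 \<and> (\<forall>y t. \<gamma> (y + t *\<^sub>R e) = \<gamma> y) \<and>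
     C_Holder_upto k \<alpha> (ball x0 r) \<gamma> \<and>
     S \<inter> ball x0 r = {x \<in> ball x0 r. \<gamma> x < x \<bullet> e}"

definition Holder_boundary :: "nat \<Rightarrow> real \<Rightarrow> 'a::euclidean_space set \<Rightarrow> bool" where
  "Holder_boundary k \<alpha> S \<longleftrightarrow> (\<forall>x0\<in>frontier S. \<exists>r e \<gamma>. graph_chart k \<alpha> S x0 r e \<gamma>)"

text \<open>
  \<open>C\<^sup>k\<^sup>+\<^sup>\<alpha>\<close> functions on the boundary: the function is \<open>C\<^sup>k\<^sup>+\<^sup>\<alpha>\<close> in the local coordinates of a graph
  chart. The point \<open>y - (y \<bullet> e) e + \<gamma>(y) e\<close> is the boundary point above the projection
  of \<open>y\<close> to the hyperplane orthogonal to \<open>e\<close>; for small \<open>\<rho>\<close> it stays inside the chart.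
\<close>

definition C_Holder_boundary ::
  "nat \<Rightarrow> real \<Rightarrow> 'a::euclidean_space set \<Rightarrow> ('a \<Rightarrow> real) \<Rightarrow> bool" where
  "C_Holder_boundary k \<alpha> S g \<longleftrightarrow>
     (\<forall>x0\<in>frontier S. \<exists>r e \<gamma> \<rho>. graph_chart k \<alpha> S x0 r e \<gamma> \<and> \<rho> > 0 \<and>
        C_Holder_upto k \<alpha> (ball x0 \<rho>) (\<lambda>y. g (y - (y \<bullet> e) *\<^sub>R e + \<gamma> y *\<^sub>R e)))"

text \<open>
  The second conjunct says that \<open>\<nu>\<close> is orthogonal to all directions tangent to the boundary
  at \<open>x\<close>; the third one fixes the orientation.
\<close>

definition outward_unit_normal :: "'a::euclidean_space set \<Rightarrow> 'a \<Rightarrow> 'a \<Rightarrow> bool" where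
  "outward_unit_normal S x \<nu> \<longleftrightarrow>
     norm \<nu> = 1 \<and>
     ((\<lambda>y. (y - x) \<bullet> \<nu> / norm (y - x)) \<longlongrightarrow> 0) (at x within frontier S) \<and>
     (\<forall>\<^sub>F t in at_right 0. x - t *\<^sub>R \<nu> \<in> S \<and> x + t *\<^sub>R \<nu> \<notin> closure S)"


section \<open>The boundary value problem\<close>

definition elliptic_on :: "(real^'n) set \<Rightarrow> (real^'n \<Rightarrow> real^'n^'n) \<Rightarrow> bool" where
  "elliptic_on A a \<longleftrightarrow>
     (\<exists>c>0. \<forall>x\<in>A. \<forall>\<xi>. (\<Sum>i\<in>UNIV. \<Sum>j\<in>UNIV. a x $ i $ j * \<xi> $ i * \<xi> $ j) \<ge> c * (norm \<xi>)\<^sup>2)"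

definition div_op :: "(real^'n \<Rightarrow> real^'n^'n) \<Rightarrow> (real^'n \<Rightarrow> real) \<Rightarrow> real^'n \<Rightarrow> real" where
  "div_op a u x =
     - (\<bar>det (a x)\<bar> powr (1/2) *
        (\<Sum>i\<in>UNIV. \<Sum>k\<in>UNIV.
           partial_deriv (axis i 1)
             (\<lambda>y. \<bar>det (a y)\<bar> powr (-1/2) * a y $ i $ k * partial_deriv (axis k 1) u y) x))"

definition solves_bvp ::
  "real \<Rightarrow> (real^'n) set \<Rightarrow> (real^'n \<Rightarrow> real^'n^'n) \<Rightarrow> (real \<Rightarrow> real) \<Rightarrow> (real^'n \<Rightarrow> real) \<Rightarrow>
   (real^'n \<Rightarrow> real) \<Rightarrow> bool" where
  "solves_bvp \<alpha> \<Omega> a F \<phi> u \<longleftrightarrow>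
     C_Holder_upto 2 \<alpha> \<Omega> u \<and>
     (\<forall>x\<in>\<Omega>. div_op a u x = F (u x)) \<and>
     (\<forall>x\<in>frontier \<Omega>. u x = \<phi> x)"

text \<open>At boundary points \<open>\<partial>\<^sub>j v\<close> means the continuous extension of \<open>\<partial>\<^sub>j v\<close> from \<open>\<Omega>\<close>.\<close>

definition conormal_deriv ::
  "(real^'n) set \<Rightarrow> (real^'n \<Rightarrow> real^'n^'n) \<Rightarrow> (real^'n \<Rightarrow> real^'n) \<Rightarrow> (real^'n \<Rightarrow> real) \<Rightarrow>
   real^'n \<Rightarrow> real" where
  "conormal_deriv \<Omega> a \<nu> v x =
     (\<Sum>i\<in>UNIV. \<Sum>j\<in>UNIV.
        a x $ i $ j * Lim (at x within \<Omega>) (partial_deriv (axis j 1) v) * \<nu> x $ i)"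

end

theory Submission
  imports Defs
begin

text \<open>
  The two nonlinearities are comparable where the solutions live. Monotonicity and \<open>F\<^sub>j 0 = 0\<close>
  give \<open>F\<^sub>j \<le> 0\<close> on \<open>[0,1]\<close>, and the weak minimum principle gives \<open>0 \<le> u\<^sub>j \<le> \<delta>\<close>. On that range
  \<open>\<bar>F\<^sub>1\<bar> / \<bar>F\<^sub>2\<bar> = \<bar>b\<^sub>1 / b\<^sub>2\<bar> s ^ (l\<^sub>1 - l\<^sub>2)\<close>, and \<open>\<delta> < m / M\<close> makes the power dominate the ratio of the
  coefficients as soon as the exponents differ. So either \<open>F\<^sub>1 = F\<^sub>2\<close>, or one of them is strictly
  below the other on the whole of \<open>(0, \<delta>]\<close> (\<open>nonlinearities_ordered\<close>).

  Suppose \<open>F\<^sub>2 < F\<^sub>1\<close> on \<open>(0, \<delta>]\<close> and put \<open>w = u\<^sub>1 - u\<^sub>2\<close>. The weak minimum principle gives \<open>w \<ge> 0\<close>.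
  Writing the operator in nondivergence form \<open>L\<close> with bounded coefficients, the Lipschitz continuity
  of \<open>F\<^sub>2\<close> on \<open>[0, \<delta>]\<close> turns the equations into \<open>L w \<le> C w\<close>. Near a boundary point where the data
  are positive, \<open>u\<^sub>1 > 0\<close>; at an interior zero of \<open>w\<close> there, \<open>L w = F\<^sub>2 u\<^sub>1 - F\<^sub>1 u\<^sub>1 < 0\<close>, which is
  impossible at a minimum. Hence \<open>w\<close> is positive somewhere, thus everywhere by the strong minimum
  principle, and the boundary point lemma of Hopf makes the conormal derivative of \<open>w\<close> negative at
  every boundary point (\<open>conormal_deriv_strict_comparison\<close>). Equality of the two conormal
  derivatives at a single point therefore excludes both strict orderings.

  Both the strong principle and the boundary point lemma come from one barrier estimate,
  \<open>supersolution_lower_bound_on_ball\<close>: on a ball around a point of positivity, a nonnegative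
  supersolution dominates a multiple of \<open>exp (- k r\<^sup>2) - exp (- k R\<^sup>2)\<close>. This is positive in the open
  ball, which propagates positivity, and it has nonzero slope on the sphere, which is what Hopf's
  lemma needs. The touching ball is provided by the boundary regularity (\<open>interior_ball\<close>).
\<close>

section \<open>Second order conditions at an interior minimum\<close>

text \<open>
  The trace of the product of a positive definite and a positive semidefinite form is nonnegative.
  Instead of diagonalizing, one index at a time is eliminated: subtracting the rank one form
  \<open>A\<^sub>i\<^sub>j A\<^sub>j\<^sub>k / A\<^sub>j\<^sub>j\<close> from \<open>A\<close> leaves the Schur complement, which is positive definite on the remaining
  indices, and the pairing of the rank one form with \<open>H\<close> is a value of the quadratic form of \<open>H\<close>.
\<close>

lemma double_sum_schur_nonneg:
  fixes A H :: "'i \<Rightarrow> 'i \<Rightarrow> real"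
  assumes "finite I"
    and "\<And>i k. A i k = A k i"
    and "\<And>\<xi>. (\<exists>i\<in>I. \<xi> i \<noteq> 0) \<Longrightarrow> 0 < (\<Sum>i\<in>I. \<Sum>k\<in>I. A i k * \<xi> i * \<xi> k)"
    and "\<And>\<xi>. 0 \<le> (\<Sum>i\<in>I. \<Sum>k\<in>I. H k i * \<xi> i * \<xi> k)"
  shows "0 \<le> (\<Sum>i\<in>I. \<Sum>k\<in>I. A i k * H k i)"
  using assms
proof (induction I arbitrary: A rule: finite_induct)
  case empty
  then show ?case by simp
next
  case (insert j I)
  note fin = insert.hyps(1) and jI = insert.hyps(2) and sym = insert.prems(1)
    and pos = insert.prems(2) and H = insert.prems(3)
  let ?J = "insert j I"
  have d: "A j j > 0"
  proof -
    have "0 < (\<Sum>i\<in>?J. \<Sum>k\<in>?J. A i k * (if i = j then 1 else 0) * (if k = j then 1 else 0))"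
      by (rule pos) auto
    also have "\<dots> = A j j"
    proof -
      have neq: "i \<in> I \<Longrightarrow> i \<noteq> j" for i using jI by auto
      show ?thesis using fin jI by (simp add: neq cong: sum.cong)
    qed
    finally show ?thesis .
  qed
  define A' where "A' i k = A i k - A i j * A j k / A j j" for i k
  have A'j: "A' i j = 0" "A' j i = 0" for i
    using d by (auto simp: A'_def)
  have A'H: "A' i k * H k i = A i k * H k i - H k i * A j i * A j k / A j j" for i k
    by (simp add: A'_def sym[of i j] left_diff_distrib)
  have "0 \<le> (\<Sum>i\<in>I. \<Sum>k\<in>I. A' i k * H k i)"
  proof (rule insert.IH)
    show "A' i k = A' k i" for i k
      by (simp add: A'_def sym[of i k] sym[of i j] sym[of j k])
    show "0 \<le> (\<Sum>i\<in>I. \<Sum>k\<in>I. H k i * \<xi> i * \<xi> k)" for \<xi>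
      using H[of "\<lambda>i. if i = j then 0 else \<xi> i"] fin jI
      by (simp add: sum.insert_if) (smt (verit, best) sum.cong)
    show "0 < (\<Sum>i\<in>I. \<Sum>k\<in>I. A' i k * \<xi> i * \<xi> k)" if nz: "\<exists>i\<in>I. \<xi> i \<noteq> 0" for \<xi>
    proof -
      define s where "s = (\<Sum>k\<in>I. A j k * \<xi> k)"
      \<comment> \<open>completing the square: this value at \<open>j\<close> minimizes the form of \<open>A\<close> over the \<open>j\<close>-th coordinate\<close>
      define \<eta> where "\<eta> i = (if i = j then - s / A j j else \<xi> i)" for i
      have \<eta>I: "\<eta> i = \<xi> i" if "i \<in> I" for i
        using that jI by (auto simp: \<eta>_def)
      have s': "(\<Sum>i\<in>I. A i j * \<xi> i) = s"
        unfolding s_def by (simp add: sym[of _ j])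
      have "0 < (\<Sum>i\<in>?J. \<Sum>k\<in>?J. A i k * \<eta> i * \<eta> k)"
        using nz by (intro pos) (auto simp: \<eta>I)
      also have "\<dots> = A j j * \<eta> j * \<eta> j + (\<Sum>k\<in>I. A j k * \<eta> j * \<xi> k)
          + ((\<Sum>i\<in>I. A i j * \<xi> i * \<eta> j) + (\<Sum>i\<in>I. \<Sum>k\<in>I. A i k * \<xi> i * \<xi> k))"
        using fin jI by (simp add: sum.distrib \<eta>I cong: sum.cong)
      also have "(\<Sum>k\<in>I. A j k * \<eta> j * \<xi> k) = \<eta> j * s"
        unfolding s_def sum_distrib_left by (simp add: mult_ac)
      also have "(\<Sum>i\<in>I. A i j * \<xi> i * \<eta> j) = \<eta> j * s"
        unfolding s'[symmetric] sum_distrib_left by (simp add: mult_ac)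
      also have "\<eta> j = - s / A j j" by (simp add: \<eta>_def)
      also have "A j j * (- s / A j j) * (- s / A j j) + - s / A j j * s
          + (- s / A j j * s + (\<Sum>i\<in>I. \<Sum>k\<in>I. A i k * \<xi> i * \<xi> k))
          = (\<Sum>i\<in>I. \<Sum>k\<in>I. A i k * \<xi> i * \<xi> k) - s * s / A j j"
        using d by (simp add: field_simps)
      also have "s * s / A j j = (\<Sum>i\<in>I. \<Sum>k\<in>I. A i j * A j k / A j j * \<xi> i * \<xi> k)"
        unfolding s'[symmetric] by (subst (2) s', unfold s_def sum_product sum_divide_distrib)
          (simp add: mult_ac)
      finally show ?thesis
        by (simp add: A'_def left_diff_distrib sum_subtractf)
    qed
  qed
  also have "\<dots> = (\<Sum>i\<in>?J. \<Sum>k\<in>?J. A' i k * H k i)"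
    using fin jI by (simp add: A'j)
  also have "\<dots> = (\<Sum>i\<in>?J. \<Sum>k\<in>?J. A i k * H k i)
      - (\<Sum>i\<in>?J. \<Sum>k\<in>?J. H k i * A j i * A j k) / A j j"
    by (simp only: A'H sum_subtractf sum_divide_distrib)
  finally have "(\<Sum>i\<in>?J. \<Sum>k\<in>?J. H k i * A j i * A j k) / A j j
      \<le> (\<Sum>i\<in>?J. \<Sum>k\<in>?J. A i k * H k i)" by simp
  moreover have "0 \<le> (\<Sum>i\<in>?J. \<Sum>k\<in>?J. H k i * A j i * A j k) / A j j"
    using d H[of "A j"] by (simp only: divide_nonneg_pos)
  ultimately show ?case by linarith
qed

lemma quadratic_form_sum:
  "\<xi> \<bullet> (A *v \<xi>) = (\<Sum>i\<in>UNIV. \<Sum>k\<in>UNIV. A $ i $ k * \<xi> $ i * \<xi> $ k)" for A :: "real^'n^'n"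
  by (simp add: inner_vec_def matrix_vector_mult_def sum_distrib_left mult_ac)

lemma trace_mult_nonneg:
  fixes A H :: "real^'n^'n"
  assumes "transpose A = A"
    and pd: "\<And>\<xi>. \<xi> \<noteq> 0 \<Longrightarrow> 0 < \<xi> \<bullet> (A *v \<xi>)"
    and H: "\<And>\<xi>. 0 \<le> \<xi> \<bullet> (H *v \<xi>)"
  shows "0 \<le> trace (A ** H)"
proof -
  have "0 \<le> (\<Sum>i\<in>UNIV. \<Sum>k\<in>UNIV. A $ i $ k * H $ k $ i)"
  proof (rule double_sum_schur_nonneg)
    show "A $ i $ k = A $ k $ i" for i k
      using assms(1) by (metis transpose_def vec_lambda_beta)
    show "0 < (\<Sum>i\<in>UNIV. \<Sum>k\<in>UNIV. A $ i $ k * \<xi> i * \<xi> k)" if "\<exists>i\<in>UNIV. \<xi> i \<noteq> 0" for \<xi>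
      using pd[of "\<chi> i. \<xi> i"] that by (simp add: quadratic_form_sum vec_eq_iff)
    show "0 \<le> (\<Sum>i\<in>UNIV. \<Sum>k\<in>UNIV. H $ k $ i * \<xi> i * \<xi> k)" for \<xi>
      using H[of "\<chi> i. \<xi> i"]
      by (subst sum.swap) (simp add: quadratic_form_sum mult_ac)
  qed simp
  then show ?thesis by (simp add: trace_def matrix_matrix_mult_def)
qed

text \<open>
  Gradient and Hessian are kept as explicit data, so that they can be combined linearly and fed to
  a differential operator without any reference to iterated partial derivatives.
\<close>

definition has_grad_hess_on ::
  "(real^'n \<Rightarrow> real) \<Rightarrow> (real^'n \<Rightarrow> real^'n) \<Rightarrow> (real^'n \<Rightarrow> real^'n^'n) \<Rightarrow> (real^'n) set \<Rightarrow> bool" where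
  "has_grad_hess_on u G H S \<longleftrightarrow>
     (\<forall>x\<in>S. (u has_derivative (\<lambda>h. G x \<bullet> h)) (at x) \<and> (G has_derivative (\<lambda>h. H x *v h)) (at x))"

lemma has_grad_hess_on_subset:
  "has_grad_hess_on u G H S \<Longrightarrow> T \<subseteq> S \<Longrightarrow> has_grad_hess_on u G H T"
  by (auto simp: has_grad_hess_on_def)

lemma has_grad_hess_on_diff_scaled:
  assumes "has_grad_hess_on u G H S" "has_grad_hess_on v G' H' S"
  shows "has_grad_hess_on (\<lambda>x. u x - k * v x) (\<lambda>x. G x - k *\<^sub>R G' x) (\<lambda>x. H x - k *\<^sub>R H' x) S"
  unfolding has_grad_hess_on_def
proof (intro ballI conjI)
  fix x assume x: "x \<in> S"
  note d = assms[unfolded has_grad_hess_on_def, rule_format, OF x]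
  show "((\<lambda>x. u x - k * v x) has_derivative (\<lambda>h. (G x - k *\<^sub>R G' x) \<bullet> h)) (at x)"
    using d by (auto intro!: derivative_eq_intros simp: inner_diff_left)
  show "((\<lambda>x. G x - k *\<^sub>R G' x) has_derivative (\<lambda>h. (H x - k *\<^sub>R H' x) *v h)) (at x)"
    using d by (auto intro!: derivative_eq_intros
        simp: matrix_vector_mult_diff_rdistrib scaleR_matrix_vector_assoc)
qed

text \<open>
  Along the line through the minimum in direction \<open>\<xi>\<close>, the derivative of \<open>f\<close> vanishes at \<open>0\<close>; a
  negative second derivative there would make it negative just after \<open>0\<close>, so \<open>f\<close> would drop below
  its minimum by the mean value theorem.
\<close>

lemma grad_hess_at_interior_min:
  assumes gh: "has_grad_hess_on f G H S" and S: "open S" "x \<in> S"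
    and min: "\<And>y. y \<in> S \<Longrightarrow> f x \<le> f y"
  shows "G x = 0" "0 \<le> \<xi> \<bullet> (H x *v \<xi>)"
proof -
  have df: "(f has_derivative (\<lambda>h. G y \<bullet> h)) (at y)" "(G has_derivative (\<lambda>h. H y *v h)) (at y)"
    if "y \<in> S" for y
    using gh that by (auto simp: has_grad_hess_on_def)
  have "(\<lambda>h. G x \<bullet> h) = (\<lambda>h. 0)"
    by (rule differential_zero_maxmin[OF S(2,1) df(1)[OF S(2)]]) (use min in auto)
  then have "G x \<bullet> G x = 0" by metis
  then show G0: "G x = 0" by simp
  show "0 \<le> \<xi> \<bullet> (H x *v \<xi>)"
  proof (rule ccontr)
    assume neg: "\<not> ?thesis"
    define p where "p t = x + t *\<^sub>R \<xi>" for t :: real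
    have p0: "p 0 = x" by (simp add: p_def)
    have dp: "(p has_derivative (\<lambda>s. s *\<^sub>R \<xi>)) (at t)" for t
      unfolding p_def by (auto intro!: derivative_eq_intros)
    have "open (p -` S)"
      by (rule open_vimage[OF S(1)]) (auto simp: p_def intro!: continuous_intros)
    then obtain r where r: "r > 0" "ball 0 r \<subseteq> p -` S"
      using S(2) p0 by (metis open_contains_ball vimageI)
    have dg: "((\<lambda>t. \<xi> \<bullet> G (p t)) has_real_derivative \<xi> \<bullet> (H x *v \<xi>)) (at 0)"
    proof -
      have "((\<lambda>t. \<xi> \<bullet> G (p t)) has_derivative (\<lambda>s. \<xi> \<bullet> (H (p 0) *v (s *\<^sub>R \<xi>)))) (at 0)"
        by (rule has_derivative_inner_right[OF has_derivative_compose[OF dp]], rule df(2))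
          (simp add: p0 S)
      moreover have "(\<lambda>s. \<xi> \<bullet> (H (p 0) *v (s *\<^sub>R \<xi>))) = (*) (\<xi> \<bullet> (H x *v \<xi>))"
        by (auto simp: p0 matrix_vector_mult_scaleR)
      ultimately show ?thesis by (simp add: has_field_derivative_def)
    qed
    obtain d where d: "d > 0" "\<And>h. 0 < h \<Longrightarrow> h < d \<Longrightarrow> \<xi> \<bullet> G (p h) < 0"
      using DERIV_neg_dec_right[OF dg] neg G0 p0 by force
    define t where "t = min r d / 2"
    have t: "0 < t" "t < r" "t < d" using r d by (auto simp: t_def)
    have "((\<lambda>t. f (p t)) has_real_derivative (\<xi> \<bullet> G (p s))) (at s)" if "\<bar>s\<bar> < r" for s
    proof -
      have "p s \<in> S" using r(2) that by auto
      from has_derivative_compose[OF dp df(1)[OF this]]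
      show ?thesis
        by (rule has_derivative_imp_has_field_derivative) (simp add: inner_commute)
    qed
    then have "\<exists>z>0. z < t \<and> f (p t) - f (p 0) = (t - 0) * (\<xi> \<bullet> G (p z))"
      using t by (intro MVT2) auto
    then obtain z where z: "0 < z" "z < t" "f (p t) - f (p 0) = t * (\<xi> \<bullet> G (p z))" by auto
    have "f (p t) < f x"
      using d(2)[of z] z t p0 mult_pos_neg[of t "\<xi> \<bullet> G (p z)"] by auto
    moreover have "p t \<in> S" using subsetD[OF r(2), of t] t by simp
    ultimately show False using min by force
  qed
qed

section \<open>Minimum principles for elliptic operators in nondivergence form\<close>

lemma trace_mult_scaleR: "trace (X ** (p *\<^sub>R P)) = p * trace (X ** P)" for X P :: "real^'n^'n"
  by (simp add: trace_def matrix_matrix_mult_def sum_distrib_left mult_ac)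

lemma trace_mult_diff: "trace (X ** (P - Q)) = trace (X ** P) - trace (X ** Q)"
  for X P Q :: "real^'n^'n"
  by (simp add: trace_def matrix_matrix_mult_def right_diff_distrib sum_subtractf)

definition outer :: "real^'n \<Rightarrow> real^'n^'n" where
  "outer z = (\<chi> i j. z $ i * z $ j)"

lemma outer_mult_vec: "outer z *v h = (z \<bullet> h) *\<^sub>R z"
  by (simp add: outer_def vec_eq_iff matrix_vector_mult_def inner_vec_def sum_distrib_left mult_ac)

lemma trace_mult_outer: "trace (X ** outer z) = z \<bullet> (X *v z)"
  unfolding quadratic_form_sum trace_def matrix_matrix_mult_def outer_def
  by (simp add: mult_ac)

text \<open>
  The barrier behind all minimum principles below. Its concentration \<open>k\<close> is the free parameter:
  away from the centre the second derivatives grow like \<open>k\<^sup>2\<close> and beat all lower order terms.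
\<close>

definition gauss_bump :: "real^'n \<Rightarrow> real \<Rightarrow> real^'n \<Rightarrow> real" where
  "gauss_bump y k x = exp (- k * (dist x y)\<^sup>2)"

definition gauss_bump_grad :: "real^'n \<Rightarrow> real \<Rightarrow> real^'n \<Rightarrow> real^'n" where
  "gauss_bump_grad y k x = (- 2 * k * gauss_bump y k x) *\<^sub>R (x - y)"

definition gauss_bump_hess :: "real^'n \<Rightarrow> real \<Rightarrow> real^'n \<Rightarrow> real^'n^'n" where
  "gauss_bump_hess y k x =
     gauss_bump y k x *\<^sub>R
       ((4 * k\<^sup>2) *\<^sub>R outer (x - y) - (2 * k) *\<^sub>R mat 1)"

lemma gauss_bump_pos: "0 < gauss_bump y k x"
  by (simp add: gauss_bump_def)

lemma gauss_bump_le_1: "0 \<le> k \<Longrightarrow> gauss_bump y k x \<le> 1"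
  by (simp add: gauss_bump_def)

lemma has_grad_hess_gauss_bump:
  "has_grad_hess_on (gauss_bump y k) (gauss_bump_grad y k) (gauss_bump_hess y k) S"
  unfolding has_grad_hess_on_def
proof (intro ballI conjI)
  fix x
  have eq: "gauss_bump y k = (\<lambda>x. exp (- k * ((x - y) \<bullet> (x - y))))"
    by (simp add: gauss_bump_def fun_eq_iff dist_norm power2_norm_eq_inner)
  show 1: "(gauss_bump y k has_derivative (\<lambda>h. gauss_bump_grad y k x \<bullet> h)) (at x)"
    unfolding gauss_bump_grad_def eq
    by (auto intro!: derivative_eq_intros simp: fun_eq_iff inner_commute algebra_simps)
  have "(gauss_bump_grad y k has_derivative
      (\<lambda>h. (- 2 * k * gauss_bump y k x) *\<^sub>R h + (- 2 * k * (gauss_bump_grad y k x \<bullet> h)) *\<^sub>R (x - y)))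
      (at x)"
    unfolding gauss_bump_grad_def[abs_def]
    by (rule derivative_eq_intros 1[unfolded gauss_bump_grad_def] refl)+
       (simp add: fun_eq_iff)
  moreover have "(- 2 * k * gauss_bump y k x) *\<^sub>R h
        + (- 2 * k * (gauss_bump_grad y k x \<bullet> h)) *\<^sub>R (x - y) = gauss_bump_hess y k x *v h" for h
    unfolding gauss_bump_grad_def gauss_bump_hess_def
    by (simp only: matrix_vector_mult_diff_rdistrib scaleR_matrix_vector_assoc[symmetric]
        outer_mult_vec matrix_vector_mul_lid inner_scaleR_left)
      (simp add: scaleR_right_diff_distrib power2_eq_square mult_ac)
  ultimately show "(gauss_bump_grad y k has_derivative (\<lambda>h. gauss_bump_hess y k x *v h)) (at x)"
    by simp
qed

lemma continuous_on_gauss_bump: "continuous_on S (gauss_bump y k)"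
  unfolding gauss_bump_def[abs_def] by (intro continuous_intros)

text \<open>
  The operator \<open>u \<mapsto> trace (A D\<^sup>2u) + B \<bullet> \<nabla>u\<close>. The trace of \<open>A\<close> enters the
  image of the barrier with a negative sign only, whence the one-sided bound.
\<close>

locale elliptic_operator =
  fixes \<Omega> :: "(real^'n) set"
    and A :: "real^'n \<Rightarrow> real^'n^'n"
    and B :: "real^'n \<Rightarrow> real^'n"
    and c \<Lambda> :: real
  assumes open_dom: "open \<Omega>"
    and c_pos: "0 < c"
    and A_sym: "x \<in> \<Omega> \<Longrightarrow> transpose (A x) = A x"
    and A_ell: "x \<in> \<Omega> \<Longrightarrow> c * (norm \<xi>)\<^sup>2 \<le> \<xi> \<bullet> (A x *v \<xi>)"
    and A_bound: "x \<in> \<Omega> \<Longrightarrow> trace (A x) \<le> \<Lambda>"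
    and B_bound: "x \<in> \<Omega> \<Longrightarrow> norm (B x) \<le> \<Lambda>"
begin

definition L :: "(real^'n \<Rightarrow> real^'n) \<Rightarrow> (real^'n \<Rightarrow> real^'n^'n) \<Rightarrow> real^'n \<Rightarrow> real" where
  "L G H x = trace (A x ** H x) + B x \<bullet> G x"

lemma L_diff_scaled:
  "L (\<lambda>x. G x - k *\<^sub>R G' x) (\<lambda>x. H x - k *\<^sub>R H' x) x = L G H x - k * L G' H' x"
  by (simp add: L_def trace_mult_diff trace_mult_scaleR inner_diff_right algebra_simps)

lemma L_nonneg_at_interior_min:
  assumes "has_grad_hess_on f G H S" "open S" "S \<subseteq> \<Omega>" "x \<in> S"
    and "\<And>y. y \<in> S \<Longrightarrow> f x \<le> f y"
  shows "0 \<le> L G H x"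
proof -
  note min = grad_hess_at_interior_min[OF assms(1,2,4,5)]
  have x: "x \<in> \<Omega>" using assms by blast
  have "0 \<le> trace (A x ** H x)"
  proof (rule trace_mult_nonneg[OF A_sym[OF x] _ min(2)])
    fix \<xi> :: "real^'n" assume "\<xi> \<noteq> 0"
    then have "0 < c * (norm \<xi>)\<^sup>2" using c_pos by simp
    then show "0 < \<xi> \<bullet> (A x *v \<xi>)" using A_ell[OF x, of \<xi>] by linarith
  qed auto
  then show ?thesis by (simp add: L_def min(1))
qed

lemma L_gauss_bump:
  "L (gauss_bump_grad y k) (gauss_bump_hess y k) x =
    gauss_bump y k x * (4 * k\<^sup>2 * ((x - y) \<bullet> (A x *v (x - y))) - 2 * k * trace (A x)
      - 2 * k * (B x \<bullet> (x - y)))"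
  unfolding L_def gauss_bump_grad_def gauss_bump_hess_def
  by (simp only: trace_mult_diff trace_mult_scaleR trace_mult_outer matrix_mul_rid inner_scaleR_right)
    (simp add: algebra_simps)

text \<open>
  With \<open>z = x - y\<close>, the bump times \<open>4 k\<^sup>2 (z \<bullet> A z) - 2 k (trace A + B \<bullet> z)\<close> is the image of the bump.
  In an annulus the first term is at least \<open>4 k\<^sup>2 c \<rho>\<^sup>2\<close> while the second is linear in \<open>k\<close>.
\<close>

lemma ex_gauss_bump_strict_subsolution:
  assumes "0 < \<rho>"
  obtains k where "0 < k"
    and "\<And>x. x \<in> \<Omega> \<Longrightarrow> \<rho> \<le> dist x y \<Longrightarrow> dist x y \<le> R \<Longrightarrow>
           C * gauss_bump y k x < L (gauss_bump_grad y k) (gauss_bump_hess y k) x"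
proof -
  define K where "K = \<bar>\<Lambda> * (1 + R)\<bar>"
  define k where "k = max 1 ((2 * K + \<bar>C\<bar> + 1) / (4 * c * \<rho>\<^sup>2))"
  have cr: "0 < 4 * c * \<rho>\<^sup>2" using c_pos assms by simp
  have k: "1 \<le> k" "2 * K + \<bar>C\<bar> + 1 \<le> k * (4 * c * \<rho>\<^sup>2)"
    unfolding k_def using cr by (auto simp: max_def field_simps)
  show thesis
  proof
    show "0 < k" using k by simp
    fix x assume x: "x \<in> \<Omega>" "\<rho> \<le> dist x y" "dist x y \<le> R"
    let ?z = "x - y"
    have \<Lambda>: "0 \<le> \<Lambda>" using B_bound[OF x(1)] norm_ge_zero order_trans by blast
    have "c * \<rho>\<^sup>2 \<le> c * (norm ?z)\<^sup>2"
      using x(2) assms c_pos by (intro mult_left_mono power_mono) (auto simp: dist_norm)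
    then have q: "c * \<rho>\<^sup>2 \<le> ?z \<bullet> (A x *v ?z)" using A_ell[OF x(1), of ?z] by linarith
    have "B x \<bullet> ?z \<le> norm (B x) * norm ?z" by (rule norm_cauchy_schwarz)
    also have "\<dots> \<le> \<Lambda> * R"
      using B_bound[OF x(1)] x(3) \<Lambda> by (intro mult_mono) (auto simp: dist_norm)
    finally have b: "trace (A x) + B x \<bullet> ?z \<le> K"
      using A_bound[OF x(1)] by (auto simp: K_def algebra_simps)
    have "C < 1 * (\<bar>C\<bar> + 1)" by simp
    also have "\<dots> \<le> k * (k * (4 * c * \<rho>\<^sup>2) - 2 * K)"
      using k by (intro mult_mono) auto
    also have "\<dots> = 4 * k\<^sup>2 * (c * \<rho>\<^sup>2) - 2 * k * K"
      by (simp add: algebra_simps power2_eq_square)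
    also have "\<dots> \<le> 4 * k\<^sup>2 * (?z \<bullet> (A x *v ?z)) - 2 * k * (trace (A x) + B x \<bullet> ?z)"
      using q b k by (intro diff_mono mult_left_mono) auto
    also have "\<dots> = 4 * k\<^sup>2 * (?z \<bullet> (A x *v ?z)) - 2 * k * trace (A x) - 2 * k * (B x \<bullet> ?z)"
      by (simp only: distrib_left diff_diff_eq)
    finally show "C * gauss_bump y k x < L (gauss_bump_grad y k) (gauss_bump_hess y k) x"
      unfolding L_gauss_bump
      by (subst mult.commute) (rule mult_strict_left_mono[OF _ gauss_bump_pos])
  qed
qed

text \<open>
  Subtracting a small multiple of a strict subsolution makes the inequality at a negative interior
  minimum strict, contradicting the second order condition. The bump is centred at distance at
  least \<open>1\<close> from the domain, so that it is a strict subsolution on all of it.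
\<close>

lemma weak_minimum_principle:
  assumes bdd: "bounded \<Omega>" and cont: "continuous_on (closure \<Omega>) w"
    and gh: "has_grad_hess_on w G H \<Omega>"
    and bdry: "\<And>x. x \<in> frontier \<Omega> \<Longrightarrow> 0 \<le> w x"
    and sup: "\<And>x. x \<in> \<Omega> \<Longrightarrow> w x < 0 \<Longrightarrow> L G H x \<le> 0"
    and x: "x \<in> closure \<Omega>"
  shows "0 \<le> w x"
proof (rule ccontr)
  assume neg: "\<not> 0 \<le> w x"
  have comp: "compact (closure \<Omega>)" and ne: "closure \<Omega> \<noteq> {}"
    using bdd x by auto
  obtain p where p: "p \<in> closure \<Omega>" "\<And>z. z \<in> closure \<Omega> \<Longrightarrow> w p \<le> w z"
    using continuous_attains_inf[OF comp ne cont] by blast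
  have wp: "w p < 0" using p(2)[OF x] neg by simp
  obtain r where r: "r > 0" "\<And>z. z \<in> \<Omega> \<Longrightarrow> norm z \<le> r"
    using bdd by (auto simp: bounded_pos)
  define y :: "real^'n" where "y = (r + 1) *\<^sub>R axis undefined 1"
  have ny: "norm y = r + 1" using r(1) by (simp add: y_def norm_axis_1)
  have far: "1 \<le> dist z y" "dist z y \<le> 2 * r + 1" if "z \<in> \<Omega>" for z
    using r(2)[OF that] ny norm_triangle_ineq2[of y z] norm_triangle_ineq4[of z y]
    by (auto simp: dist_norm norm_minus_commute)
  obtain k where k: "0 < k"
    "\<And>z. z \<in> \<Omega> \<Longrightarrow> 0 < L (gauss_bump_grad y k) (gauss_bump_hess y k) z"
    using ex_gauss_bump_strict_subsolution[of 1 y "2 * r + 1" 0] far by (metis mult_zero_left zero_less_one)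
  define \<epsilon> where "\<epsilon> = - w p / 2"
  have \<epsilon>: "\<epsilon> > 0" using wp by (simp add: \<epsilon>_def)
  obtain q where q: "q \<in> closure \<Omega>"
    "\<And>z. z \<in> closure \<Omega> \<Longrightarrow> w q - \<epsilon> * gauss_bump y k q \<le> w z - \<epsilon> * gauss_bump y k z"
    using continuous_attains_inf[OF comp ne continuous_on_diff[OF cont
          continuous_on_mult_left[OF continuous_on_gauss_bump]]] by blast
  have "\<epsilon> * gauss_bump y k q \<le> \<epsilon>"
    using \<epsilon> gauss_bump_le_1[of k y q] k(1) by simp
  moreover have "0 < \<epsilon> * gauss_bump y k p" using \<epsilon> by (simp add: gauss_bump_pos)
  ultimately have wq: "w q < 0"
    using q(2)[OF p(1)] \<epsilon> unfolding \<epsilon>_def by argo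
  then have q\<Omega>: "q \<in> \<Omega>"
    using q(1) bdry[of q] open_dom by (auto simp: frontier_def interior_open)
  have "0 \<le> L (\<lambda>x. G x - \<epsilon> *\<^sub>R gauss_bump_grad y k x) (\<lambda>x. H x - \<epsilon> *\<^sub>R gauss_bump_hess y k x) q"
    using q(2) closure_subset
    by (intro L_nonneg_at_interior_min[OF has_grad_hess_on_diff_scaled[OF gh
          has_grad_hess_gauss_bump] open_dom order_refl q\<Omega>]) blast
  then have "0 \<le> L G H q - \<epsilon> * L (gauss_bump_grad y k) (gauss_bump_hess y k) q"
    by (simp add: L_diff_scaled)
  moreover have "0 < \<epsilon> * L (gauss_bump_grad y k) (gauss_bump_hess y k) q"
    using \<epsilon> k(2)[OF q\<Omega>] by simp
  ultimately show False using sup[OF q\<Omega> wq] by linarith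
qed

text \<open>
  Comparison with the bump, shifted to vanish on the sphere: near the centre \<open>w\<close> is bounded below by
  continuity, on the sphere by nonnegativity, and in the annulus between them a negative minimum of
  the difference is excluded because the bump is a strict subsolution there.
\<close>

lemma supersolution_lower_bound_on_ball:
  assumes R: "0 < R" "ball y R \<subseteq> \<Omega>" and C: "0 \<le> C"
    and cont: "continuous_on (cball y R) w"
    and gh: "has_grad_hess_on w G H (ball y R)"
    and nonneg: "\<And>x. x \<in> cball y R \<Longrightarrow> 0 \<le> w x"
    and sup: "\<And>x. x \<in> ball y R \<Longrightarrow> L G H x \<le> C * w x"
    and pos: "0 < w y"
  obtains \<epsilon> k where "0 < \<epsilon>" "0 < k"
    "\<And>x. x \<in> cball y R \<Longrightarrow> \<epsilon> * (gauss_bump y k x - exp (- k * R\<^sup>2)) \<le> w x"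
proof -
  have "\<exists>d>0. \<forall>x\<in>cball y R. dist x y < d \<longrightarrow> dist (w x) (w y) < w y / 2"
    by (rule bspec[OF cont[unfolded continuous_on_iff], of y, rule_format])
      (use R(1) pos in auto)
  then obtain d where d: "d > 0"
    "\<And>x. x \<in> cball y R \<Longrightarrow> dist x y < d \<Longrightarrow> \<bar>w x - w y\<bar> < w y / 2"
    by (auto simp: dist_real_def)
  \<comment> \<open>on the ball of radius \<open>\<rho>\<close>, where the bump may fail to be a subsolution, continuity keeps \<open>w\<close> above \<open>\<epsilon>\<close>\<close>
  define \<rho> where "\<rho> = min d R"
  have \<rho>: "0 < \<rho>" using d R by (simp add: \<rho>_def)
  define \<epsilon> where "\<epsilon> = w y / 2"
  have \<epsilon>: "0 < \<epsilon>" using pos by (simp add: \<epsilon>_def)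
  have near: "\<epsilon> < w x" if "dist x y < \<rho>" for x
  proof -
    have "\<bar>w x - w y\<bar> < w y / 2" using d(2)[of x] that by (simp add: \<rho>_def dist_commute)
    then show ?thesis unfolding \<epsilon>_def by linarith
  qed
  obtain k where k: "0 < k"
    "\<And>x. x \<in> \<Omega> \<Longrightarrow> \<rho> \<le> dist x y \<Longrightarrow> dist x y \<le> R \<Longrightarrow>
       C * gauss_bump y k x < L (gauss_bump_grad y k) (gauss_bump_hess y k) x"
    using ex_gauss_bump_strict_subsolution[OF \<rho>] by metis
  define f where "f x = w x - \<epsilon> * gauss_bump y k x" for x
  have "compact (cball y R)" "cball y R \<noteq> {}" using R by auto
  moreover have "continuous_on (cball y R) f"
    unfolding f_def[abs_def] by (intro continuous_intros cont continuous_on_gauss_bump)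
  ultimately obtain q where q: "q \<in> cball y R" "\<And>x. x \<in> cball y R \<Longrightarrow> f q \<le> f x"
    using continuous_attains_inf by metis
  have "- \<epsilon> * exp (- k * R\<^sup>2) \<le> f q"
  proof (rule ccontr)
    assume "\<not> ?thesis"
    then have fq: "w q < \<epsilon> * (gauss_bump y k q - exp (- k * R\<^sup>2))"
      by (simp add: f_def algebra_simps)
    have "\<epsilon> * (gauss_bump y k q - exp (- k * R\<^sup>2)) \<le> \<epsilon> * 1"
    proof (rule mult_left_mono)
      show "gauss_bump y k q - exp (- k * R\<^sup>2) \<le> 1"
        using gauss_bump_le_1[of k y q] k(1) exp_gt_zero[of "- k * R\<^sup>2"] by linarith
    qed (use \<epsilon> in simp)
    then have "w q < \<epsilon>" using fq by simp
    then have far: "\<rho> \<le> dist q y" using near[of q] by force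
    have "dist q y \<noteq> R"
      using fq nonneg[OF q(1)] by (auto simp: gauss_bump_def)
    then have qb: "q \<in> ball y R" using q(1) by (auto simp: dist_commute)
    have "w q < \<epsilon> * gauss_bump y k q"
      using fq \<epsilon> mult_pos_pos[OF \<epsilon> exp_gt_zero[of "- k * R\<^sup>2"]] by (simp only: right_diff_distrib)
    then have "C * w q \<le> C * (\<epsilon> * gauss_bump y k q)" using C by (intro mult_left_mono) auto
    also have "\<dots> = \<epsilon> * (C * gauss_bump y k q)" by simp
    also have "\<dots> < \<epsilon> * L (gauss_bump_grad y k) (gauss_bump_hess y k) q"
      using k(2)[of q] far qb subsetD[OF R(2) qb] \<epsilon> by (simp add: dist_commute)
    finally have "L G H q < \<epsilon> * L (gauss_bump_grad y k) (gauss_bump_hess y k) q"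
      using sup[OF qb] by linarith
    moreover have "0 \<le> L (\<lambda>x. G x - \<epsilon> *\<^sub>R gauss_bump_grad y k x)
        (\<lambda>x. H x - \<epsilon> *\<^sub>R gauss_bump_hess y k x) q"
      using q(2) by (intro L_nonneg_at_interior_min[OF has_grad_hess_on_diff_scaled[OF gh
          has_grad_hess_gauss_bump] open_ball R(2) qb]) (auto simp: f_def)
    ultimately show False by (simp add: L_diff_scaled)
  qed
  then have "\<epsilon> * (gauss_bump y k x - exp (- k * R\<^sup>2)) \<le> w x" if "x \<in> cball y R" for x
    using q(2)[OF that] by (simp add: f_def algebra_simps)
  with \<epsilon> k(1) show thesis by (rule that)
qed

text \<open>
  The zero set of \<open>w\<close> is open: a point of positivity close to a zero \<open>z\<close> is the centre of a ball in
  the domain that contains \<open>z\<close>, and the lower bound on that ball would make \<open>w z\<close> positive. So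
  connectedness leaves no room for zeros.
\<close>

lemma strong_minimum_principle:
  assumes conn: "connected \<Omega>" and C: "0 \<le> C"
    and gh: "has_grad_hess_on w G H \<Omega>"
    and nonneg: "\<And>x. x \<in> \<Omega> \<Longrightarrow> 0 \<le> w x"
    and sup: "\<And>x. x \<in> \<Omega> \<Longrightarrow> L G H x \<le> C * w x"
    and p: "p \<in> \<Omega>" "0 < w p" and x: "x \<in> \<Omega>"
  shows "0 < w x"
proof -
  have cont: "continuous_on S w" if "S \<subseteq> \<Omega>" for S
    using gh that unfolding has_grad_hess_on_def
    by (intro differentiable_imp_continuous_on differentiable_at_imp_differentiable_on)
      (auto simp: differentiable_def)
  define P where "P = {z \<in> \<Omega>. 0 < w z}"
  define Z where "Z = {z \<in> \<Omega>. w z = 0}"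
  have "open P"
    using continuous_open_preimage[OF cont[OF order_refl] open_dom, of "{0<..}"]
    by (auto simp: P_def vimage_def Int_def)
  moreover have "open Z"
  unfolding open_contains_ball
  proof (rule ballI)
    fix z assume z: "z \<in> Z"
    then obtain r where r: "r > 0" "ball z r \<subseteq> \<Omega>"
      using open_dom by (auto simp: Z_def open_contains_ball)
    have "ball z (r / 4) \<subseteq> Z"
    proof
      fix y assume y: "y \<in> ball z (r / 4)"
      have sub: "cball y (r / 2) \<subseteq> \<Omega>"
      proof
        fix v assume "v \<in> cball y (r / 2)"
        then have "dist z v < r" using y r(1) dist_triangle[of z v y] by simp
        then show "v \<in> \<Omega>" using r(2) by auto
      qed
      have y\<Omega>: "y \<in> \<Omega>" using sub r(1) by auto
      show "y \<in> Z"
      proof (rule ccontr)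
        assume "y \<notin> Z"
        then have "0 < w y" using nonneg[OF y\<Omega>] y\<Omega> by (auto simp: Z_def)
        have bsub: "ball y (r / 2) \<subseteq> \<Omega>" using sub ball_subset_cball by blast
        obtain \<epsilon> k where *: "0 < \<epsilon>" "0 < k"
          "\<And>x. x \<in> cball y (r / 2) \<Longrightarrow> \<epsilon> * (gauss_bump y k x - exp (- k * (r / 2)\<^sup>2)) \<le> w x"
        proof (rule supersolution_lower_bound_on_ball)
          show "0 < r / 2" using r(1) by simp
          show "continuous_on (cball y (r / 2)) w" by (rule cont[OF sub])
          show "has_grad_hess_on w G H (ball y (r / 2))" by (rule has_grad_hess_on_subset[OF gh bsub])
          show "0 \<le> w x" if "x \<in> cball y (r / 2)" for x using sub that nonneg by auto
          show "L G H x \<le> C * w x" if "x \<in> ball y (r / 2)" for x using bsub that sup by auto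
        qed (use bsub C \<open>0 < w y\<close> in auto)
        have dz: "dist z y < r / 2" using y r(1) by simp
        then have "k * (dist z y)\<^sup>2 < k * (r / 2)\<^sup>2"
          using *(2) by (intro mult_strict_left_mono power_strict_mono) auto
        then have "0 < \<epsilon> * (gauss_bump y k z - exp (- k * (r / 2)\<^sup>2))"
          using *(1) by (simp add: gauss_bump_def)
        also have "\<dots> \<le> w z" using *(3) dz by (simp add: dist_commute)
        finally show False using z by (simp add: Z_def)
      qed
    qed
    then show "\<exists>e>0. ball z e \<subseteq> Z"
      using r(1) by (intro exI[of _ "r / 4"]) auto
  qed
  moreover have "\<Omega> \<subseteq> P \<union> Z" using nonneg by (force simp: P_def Z_def)
  moreover have "P \<inter> Z \<inter> \<Omega> = {}" by (auto simp: P_def Z_def)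
  ultimately have "P \<inter> \<Omega> = {} \<or> Z \<inter> \<Omega> = {}" using connectedD[OF conn] by blast
  then have "x \<notin> Z" using p x by (auto simp: P_def Z_def)
  then show ?thesis using x nonneg[OF x] by (auto simp: Z_def)
qed

text \<open>
  The lower bound on the interior ball grows linearly along the segment leaving \<open>x0\<close> in direction
  \<open>- \<beta>\<close>, which enters the ball since \<open>\<beta> \<bullet> \<nu> > 0\<close>. Any such \<open>\<beta>\<close> is admitted, not only the normal, so the
  conormal direction can be inserted directly. The derivative at \<open>x0\<close> is the limit of the interior
  gradients, which is reached through the mean value theorem.
\<close>

lemma hopf_boundary_point:
  assumes R: "0 < R" "ball (x0 - R *\<^sub>R \<nu>) R \<subseteq> \<Omega>" and \<nu>: "norm \<nu> = 1" and C: "0 \<le> C"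
    and cont: "continuous_on (closure \<Omega>) w" and gh: "has_grad_hess_on w G H \<Omega>"
    and nonneg: "\<And>x. x \<in> closure \<Omega> \<Longrightarrow> 0 \<le> w x" and pos: "\<And>x. x \<in> \<Omega> \<Longrightarrow> 0 < w x"
    and sup: "\<And>x. x \<in> \<Omega> \<Longrightarrow> L G H x \<le> C * w x"
    and x0: "w x0 = 0"
    and \<beta>: "0 < \<beta> \<bullet> \<nu>"
    and lim: "((\<lambda>x. G x \<bullet> \<beta>) \<longlongrightarrow> l) (at x0 within \<Omega>)"
  shows "l < 0"
proof -
  define y where "y = x0 - R *\<^sub>R \<nu>"
  have sub: "ball y R \<subseteq> \<Omega>" using R by (simp add: y_def)
  have csub: "cball y R \<subseteq> closure \<Omega>" using closure_mono[OF sub] R(1) by simp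
  obtain \<epsilon> k where k: "0 < \<epsilon>" "0 < k"
    "\<And>x. x \<in> cball y R \<Longrightarrow> \<epsilon> * (gauss_bump y k x - exp (- k * R\<^sup>2)) \<le> w x"
  proof (rule supersolution_lower_bound_on_ball)
    show "continuous_on (cball y R) w" by (rule continuous_on_subset[OF cont csub])
    show "has_grad_hess_on w G H (ball y R)" by (rule has_grad_hess_on_subset[OF gh sub])
    show "0 \<le> w x" if "x \<in> cball y R" for x using csub that nonneg by auto
    show "L G H x \<le> C * w x" if "x \<in> ball y R" for x using sub that sup by auto
    show "0 < w y" using sub R(1) by (intro pos) auto
  qed (use R(1) sub C in auto)
  define p where "p t = x0 - t *\<^sub>R \<beta>" for t :: real
  \<comment> \<open>for \<open>t \<le> t0\<close> the quadratic term of the squared distance to the centre is at most half of the linear one\<close>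
  define t0 where "t0 = R * (\<beta> \<bullet> \<nu>) / (\<beta> \<bullet> \<beta>)"
  have \<beta>\<beta>: "0 < \<beta> \<bullet> \<beta>" using \<beta> by auto
  have t0: "0 < t0" using R(1) \<beta> \<beta>\<beta> by (simp add: t0_def)
  have depth: "(dist (p t) y)\<^sup>2 \<le> R\<^sup>2 - t * R * (\<beta> \<bullet> \<nu>)" if t: "0 \<le> t" "t \<le> t0" for t
  proof -
    have eq: "p t - y = R *\<^sub>R \<nu> - t *\<^sub>R \<beta>" by (simp add: p_def y_def)
    have "(dist (p t) y)\<^sup>2 = R\<^sup>2 * (\<nu> \<bullet> \<nu>) - 2 * t * R * (\<beta> \<bullet> \<nu>) + t * (t * (\<beta> \<bullet> \<beta>))"
      unfolding dist_norm eq power2_norm_eq_inner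
      by (simp add: inner_diff_left inner_diff_right inner_commute power2_eq_square algebra_simps)
    moreover have "t * (t * (\<beta> \<bullet> \<beta>)) \<le> t * (R * (\<beta> \<bullet> \<nu>))"
      using t \<beta>\<beta> by (intro mult_left_mono) (auto simp: t0_def pos_le_divide_eq)
    ultimately show ?thesis using \<nu> by (simp add: norm_eq_1 mult_ac)
  qed
  have inside: "p t \<in> ball y R" if t: "0 < t" "t \<le> t0" for t
  proof -
    have "0 < t * R * (\<beta> \<bullet> \<nu>)" using t R(1) \<beta> by simp
    then have "(dist (p t) y)\<^sup>2 < R\<^sup>2" using depth[of t] t by linarith
    then show ?thesis using R(1) by (simp add: dist_commute power_less_imp_less_base)
  qed
  \<comment> \<open>half of the slope along \<open>\<beta>\<close> of the scaled bump at the sphere; the other half absorbs the quadratic term\<close>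
  define \<kappa> where "\<kappa> = \<epsilon> * (exp (- k * R\<^sup>2) * (k * (R * (\<beta> \<bullet> \<nu>))))"
  have \<kappa>: "0 < \<kappa>" using k R(1) \<beta> by (simp add: \<kappa>_def)
  have growth: "t * \<kappa> \<le> w (p t)" if t: "0 < t" "t \<le> t0" for t
  proof -
    have "t * R * (\<beta> \<bullet> \<nu>) \<le> R\<^sup>2 - (dist (p t) y)\<^sup>2" using depth[of t] t by simp
    then have "k * (t * R * (\<beta> \<bullet> \<nu>)) \<le> k * (R\<^sup>2 - (dist (p t) y)\<^sup>2)"
      using k(2) by (intro mult_left_mono) auto
    also have "\<dots> \<le> exp (k * (R\<^sup>2 - (dist (p t) y)\<^sup>2)) - 1"
      using exp_ge_add_one_self[of "k * (R\<^sup>2 - (dist (p t) y)\<^sup>2)"] by linarith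
    finally have "exp (- k * R\<^sup>2) * (k * (t * R * (\<beta> \<bullet> \<nu>)))
        \<le> exp (- k * R\<^sup>2) * (exp (k * (R\<^sup>2 - (dist (p t) y)\<^sup>2)) - 1)"
      by (intro mult_left_mono) auto
    also have "\<dots> = gauss_bump y k (p t) - exp (- k * R\<^sup>2)"
      by (simp add: gauss_bump_def right_diff_distrib flip: exp_add)
    finally have "\<epsilon> * (exp (- k * R\<^sup>2) * (k * (t * R * (\<beta> \<bullet> \<nu>))))
        \<le> \<epsilon> * (gauss_bump y k (p t) - exp (- k * R\<^sup>2))"
      using k(1) by (intro mult_left_mono) auto
    also have "\<dots> \<le> w (p t)" using k(3)[of "p t"] inside[OF t] by auto
    finally show ?thesis by (simp add: \<kappa>_def mult_ac)
  qed
  have slope: "\<exists>s. 0 < s \<and> s < t \<and> G (p s) \<bullet> \<beta> \<le> - \<kappa>" if t: "0 < t" "t \<le> t0" for t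
  proof -
    have "\<exists>s>0. s < t \<and> w (p t) - w (p 0) = (t - 0) * - (G (p s) \<bullet> \<beta>)"
    proof -
      have "p s \<in> closure \<Omega>" if "s \<in> {0..t}" for s
      proof (cases "s = 0")
        case True
        have "x0 \<in> cball y R" using R(1) \<nu> by (simp add: y_def dist_norm)
        then show ?thesis using True csub by (auto simp: p_def)
      next
        case False
        then show ?thesis using inside[of s] that t csub by auto
      qed
      then have "p ` {0..t} \<subseteq> closure \<Omega>" by blast
      then have "continuous_on {0..t} (\<lambda>s. w (p s))"
        by (intro continuous_on_compose2[OF cont]) (auto simp: p_def intro!: continuous_intros)
      moreover have "((\<lambda>s. w (p s)) has_derivative (\<lambda>h. h * - (G (p s) \<bullet> \<beta>))) (at s)"
        if s: "0 < s" "s < t" for s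
      proof -
        have "p s \<in> \<Omega>" using inside[of s] s t sub by auto
        then have d: "(w has_derivative (\<lambda>h. G (p s) \<bullet> h)) (at (p s))"
          using gh by (simp add: has_grad_hess_on_def)
        have "(p has_derivative (\<lambda>h. - (h *\<^sub>R \<beta>))) (at s)"
          unfolding p_def[abs_def] by (auto intro!: derivative_eq_intros)
        from has_derivative_compose[OF this d] show ?thesis
          by (rule has_derivative_eq_rhs) (simp add: fun_eq_iff)
      qed
      ultimately obtain s where "0 < s" "s < t" "w (p t) - w (p 0) = (t - 0) * - (G (p s) \<bullet> \<beta>)"
        using mvt[of 0 t "\<lambda>s. w (p s)" "\<lambda>s h. h * - (G (p s) \<bullet> \<beta>)"] t(1) by auto
      then show ?thesis by blast
    qed
    then obtain s where s: "0 < s" "s < t" "w (p t) = t * - (G (p s) \<bullet> \<beta>)"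
      using x0 by (auto simp: p_def)
    then have "t * \<kappa> \<le> t * - (G (p s) \<bullet> \<beta>)" using growth[OF t] by simp
    then have "\<kappa> \<le> - (G (p s) \<bullet> \<beta>)" using t(1) by (simp only: mult_le_cancel_left_pos)
    then show ?thesis using s by (intro exI[of _ s]) auto
  qed
  have "l \<le> - \<kappa>"
  proof (rule ccontr)
    assume "\<not> l \<le> - \<kappa>"
    then have "\<forall>\<^sub>F x in at x0 within \<Omega>. - \<kappa> < G x \<bullet> \<beta>"
      by (intro order_tendstoD(1)[OF lim]) auto
    then obtain d where d: "d > 0"
      "\<And>x. x \<in> \<Omega> \<Longrightarrow> x \<noteq> x0 \<Longrightarrow> dist x x0 < d \<Longrightarrow> - \<kappa> < G x \<bullet> \<beta>"
      by (auto simp: eventually_at)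
    define t where "t = min t0 (d / norm \<beta>)"
    have n\<beta>: "0 < norm \<beta>" using \<beta>\<beta> by auto
    have t: "0 < t" "t \<le> t0" "t * norm \<beta> \<le> d"
      using t0 d(1) n\<beta> by (auto simp: t_def min_def field_simps)
    obtain s where s: "0 < s" "s < t" "G (p s) \<bullet> \<beta> \<le> - \<kappa>" using slope[OF t(1,2)] by blast
    have "dist (p s) x0 = s * norm \<beta>" using s(1) by (simp add: p_def dist_norm)
    moreover have "s * norm \<beta> < t * norm \<beta>" using s(2) n\<beta> by simp
    moreover have "p s \<in> \<Omega>" using inside[of s] s t sub by auto
    moreover have "p s \<noteq> x0" using s(1) n\<beta> by (auto simp: p_def)
    ultimately show False using d(2)[of "p s"] s(3) t(3) by simp
  qed
  then show ?thesis using \<kappa> by simp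
qed

lemma solution_range:
  assumes bdd: "bounded \<Omega>" and cont: "continuous_on (closure \<Omega>) u"
    and gh: "has_grad_hess_on u G H \<Omega>"
    and eq: "\<And>x. x \<in> \<Omega> \<Longrightarrow> L G H x = - F (u x)"
    and F: "antimono F" "F 0 = 0"
    and bdry: "\<And>x. x \<in> frontier \<Omega> \<Longrightarrow> u x \<in> {0..d}"
    and x: "x \<in> closure \<Omega>"
  shows "u x \<in> {0..max 0 d}"
proof -
  have "0 \<le> u x"
  proof (rule weak_minimum_principle[OF bdd cont gh _ _ x])
    show "L G H z \<le> 0" if "z \<in> \<Omega>" "u z < 0" for z
      using antimonoD[OF F(1), of "u z" 0] eq that F(2) by simp
  qed (use bdry in auto)
  moreover have "0 \<le> max 0 d - u x"
  proof -
    let ?d = "max 0 d"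
    have ghc: "has_grad_hess_on (\<lambda>x. ?d - 1 * u x) (\<lambda>x. 0 - 1 *\<^sub>R G x) (\<lambda>x. 0 - 1 *\<^sub>R H x) \<Omega>"
      by (rule has_grad_hess_on_diff_scaled[OF _ gh])
        (simp add: has_grad_hess_on_def)
    have "0 \<le> ?d - 1 * u x"
    proof (rule weak_minimum_principle[OF bdd _ ghc _ _ x])
      show "continuous_on (closure \<Omega>) (\<lambda>x. ?d - 1 * u x)" by (intro continuous_intros cont)
      show "0 \<le> ?d - 1 * u z" if "z \<in> frontier \<Omega>" for z
        using bdry[OF that] by simp
      show "L (\<lambda>x. 0 - 1 *\<^sub>R G x) (\<lambda>x. 0 - 1 *\<^sub>R H x) z \<le> 0"
        if z: "z \<in> \<Omega>" "?d - 1 * u z < 0" for z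
      proof -
        have "F (u z) \<le> 0" using antimonoD[OF F(1), of 0 "u z"] z(2) F(2) by simp
        moreover have "L (\<lambda>x. 0) (\<lambda>x. 0) z = 0"
          by (simp add: L_def trace_def matrix_matrix_mult_def)
        ultimately show ?thesis unfolding L_diff_scaled using eq[OF z(1)] by simp
      qed
    qed
    then show ?thesis by simp
  qed
  ultimately show ?thesis by simp
qed

text \<open>
  Where \<open>u1 < u2\<close>, monotonicity of \<open>F2\<close> and \<open>F2 \<le> F1\<close> make \<open>u1 - u2\<close> a supersolution, hence
  \<open>u2 \<le> u1\<close>. If the two agreed at an interior point with \<open>u1 > 0\<close>, that point would be a minimum of
  \<open>u1 - u2\<close> with \<open>L (u1 - u2) = F2 u1 - F1 u1 < 0\<close>. Such points exist near \<open>q\<close>, and from one point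
  of strict inequality the strong minimum principle reaches all of the domain.
\<close>

lemma semilinear_comparison:
  assumes bdd: "bounded \<Omega>" and conn: "connected \<Omega>"
    and u1: "continuous_on (closure \<Omega>) u1" "has_grad_hess_on u1 G1 H1 \<Omega>"
      "\<And>x. x \<in> \<Omega> \<Longrightarrow> L G1 H1 x = - F1 (u1 x)"
    and u2: "continuous_on (closure \<Omega>) u2" "has_grad_hess_on u2 G2 H2 \<Omega>"
      "\<And>x. x \<in> \<Omega> \<Longrightarrow> L G2 H2 x = - F2 (u2 x)"
    and F1: "antimono F1" "F1 0 = 0" and F2: "antimono F2" "F2 0 = 0"
    and lip: "\<And>s t. s \<in> {0..d} \<Longrightarrow> t \<in> {0..d} \<Longrightarrow> \<bar>F2 s - F2 t\<bar> \<le> C * \<bar>s - t\<bar>"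
    and less: "\<And>s. s \<in> {0<..d} \<Longrightarrow> F2 s < F1 s"
    and bdry: "\<And>x. x \<in> frontier \<Omega> \<Longrightarrow> u1 x = u2 x" "\<And>x. x \<in> frontier \<Omega> \<Longrightarrow> u1 x \<in> {0..d}"
    and q: "q \<in> frontier \<Omega>" "0 < u1 q"
  shows "x \<in> closure \<Omega> \<Longrightarrow> u2 x \<le> u1 x" "x \<in> \<Omega> \<Longrightarrow> u2 x < u1 x"
    "x \<in> \<Omega> \<Longrightarrow> L (\<lambda>x. G1 x - 1 *\<^sub>R G2 x) (\<lambda>x. H1 x - 1 *\<^sub>R H2 x) x \<le> C * (u1 x - u2 x)"
proof -
  have d: "0 \<le> d" using bdry(2)[OF q(1)] by auto
  have r1: "u1 x \<in> {0..d}" if "x \<in> closure \<Omega>" for x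
    using solution_range[OF bdd u1 F1 bdry(2) that] d by simp
  have r2: "u2 x \<in> {0..d}" if "x \<in> closure \<Omega>" for x
    using solution_range[OF bdd u2 F2 _ that, of d] bdry d by simp
  have le: "F2 s \<le> F1 s" if "s \<in> {0..d}" for s
    using less[of s] that F1(2) F2(2) by (cases "s = 0") auto
  have gh: "has_grad_hess_on (\<lambda>x. u1 x - 1 * u2 x) (\<lambda>x. G1 x - 1 *\<^sub>R G2 x) (\<lambda>x. H1 x - 1 *\<^sub>R H2 x) \<Omega>"
    by (rule has_grad_hess_on_diff_scaled[OF u1(2) u2(2)])
  have Lw: "L (\<lambda>x. G1 x - 1 *\<^sub>R G2 x) (\<lambda>x. H1 x - 1 *\<^sub>R H2 x) x = F2 (u2 x) - F1 (u1 x)"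
    if "x \<in> \<Omega>" for x
    unfolding L_diff_scaled using u1(3)[OF that] u2(3)[OF that] by simp
  have cl: "x \<in> closure \<Omega>" if "x \<in> \<Omega>" for x using that closure_subset by blast
  have w: "u2 x \<le> u1 x" if x: "x \<in> closure \<Omega>" for x
  proof -
    have "0 \<le> u1 x - 1 * u2 x"
    proof (rule weak_minimum_principle[OF bdd _ gh _ _ x])
      show "continuous_on (closure \<Omega>) (\<lambda>x. u1 x - 1 * u2 x)" by (intro continuous_intros u1 u2)
      show "0 \<le> u1 z - 1 * u2 z" if "z \<in> frontier \<Omega>" for z using bdry(1)[OF that] by simp
      show "L (\<lambda>x. G1 x - 1 *\<^sub>R G2 x) (\<lambda>x. H1 x - 1 *\<^sub>R H2 x) z \<le> 0"
        if z: "z \<in> \<Omega>" "u1 z - 1 * u2 z < 0" for z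
        using Lw[OF z(1)] antimonoD[OF F2(1), of "u1 z" "u2 z"] le[OF r1[OF cl[OF z(1)]]] z(2)
        by simp
    qed
    then show ?thesis by simp
  qed
  then show "x \<in> closure \<Omega> \<Longrightarrow> u2 x \<le> u1 x" .
  have Lle: "L (\<lambda>x. G1 x - 1 *\<^sub>R G2 x) (\<lambda>x. H1 x - 1 *\<^sub>R H2 x) x \<le> C * (u1 x - u2 x)"
    if x: "x \<in> \<Omega>" for x
    using Lw[OF x] le[OF r1[OF cl[OF x]]] lip[OF r2[OF cl[OF x]] r1[OF cl[OF x]]] w[OF cl[OF x]]
    by simp
  then show "x \<in> \<Omega> \<Longrightarrow> L (\<lambda>x. G1 x - 1 *\<^sub>R G2 x) (\<lambda>x. H1 x - 1 *\<^sub>R H2 x) x \<le> C * (u1 x - u2 x)" .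
  obtain p where p: "p \<in> \<Omega>" "0 < u1 p"
  proof -
    have qc: "q \<in> closure \<Omega>" using q(1) by (simp add: frontier_def)
    have "(u1 \<longlongrightarrow> u1 q) (at q within closure \<Omega>)" using u1(1) qc by (simp add: continuous_on_def)
    then have "\<forall>\<^sub>F x in at q within closure \<Omega>. 0 < u1 x" using q(2) by (rule order_tendstoD)
    then obtain \<epsilon> where \<epsilon>: "\<epsilon> > 0"
      "\<And>x. x \<in> closure \<Omega> \<Longrightarrow> x \<noteq> q \<Longrightarrow> dist x q < \<epsilon> \<Longrightarrow> 0 < u1 x"
      by (auto simp: eventually_at)
    obtain p where p: "p \<in> \<Omega>" "dist p q < \<epsilon>" using qc \<epsilon>(1) by (metis closure_approachable)
    then have "0 < u1 p" using \<epsilon>(2)[of p] cl q(2) by (cases "p = q") auto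
    with p show thesis using that by blast
  qed
  have wp: "u2 p < u1 p"
  proof (rule ccontr)
    assume "\<not> ?thesis"
    then have eq: "u1 p = u2 p" using w[OF cl[OF p(1)]] by simp
    have "0 \<le> L (\<lambda>x. G1 x - 1 *\<^sub>R G2 x) (\<lambda>x. H1 x - 1 *\<^sub>R H2 x) p"
      using eq w cl by (intro L_nonneg_at_interior_min[OF gh open_dom order_refl p(1)]) auto
    then have "F1 (u1 p) \<le> F2 (u1 p)" using Lw[OF p(1)] eq by simp
    moreover have "F2 (u1 p) < F1 (u1 p)" using r1[OF cl[OF p(1)]] p(2) by (intro less) auto
    ultimately show False by simp
  qed
  have C: "0 \<le> C"
    using lip[OF r1[OF cl[OF p(1)]] r2[OF cl[OF p(1)]]] wp
    by (smt (verit) zero_less_abs_iff mult_less_0_iff)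
  show "u2 x < u1 x" if x: "x \<in> \<Omega>"
  proof -
    have "0 < u1 x - 1 * u2 x"
    proof (rule strong_minimum_principle[OF conn C gh _ _ p(1) _ x])
      show "0 \<le> u1 z - 1 * u2 z" if "z \<in> \<Omega>" for z using w[OF cl[OF that]] by simp
      show "L (\<lambda>x. G1 x - 1 *\<^sub>R G2 x) (\<lambda>x. H1 x - 1 *\<^sub>R H2 x) z \<le> C * (u1 z - 1 * u2 z)"
        if "z \<in> \<Omega>" for z using Lle[OF that] by simp
      show "0 < u1 p - 1 * u2 p" using wp by simp
    qed
    then show ?thesis by simp
  qed
qed

end

section \<open>Regularity up to the boundary\<close>

lemma C_Holder_upto_imp_C_upto: "C_Holder_upto k \<alpha> S u \<Longrightarrow> C_upto k S u"
proof (induction k arbitrary: u)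
  case (Suc k)
  then show ?case unfolding C_Holder_upto.simps C_upto.simps by blast
qed simp

lemma partial_deriv_eq:
  assumes "(u has_derivative D) (at x)"
  shows "partial_deriv b u x = D b"
proof -
  have p: "((\<lambda>t. x + t *\<^sub>R b) has_derivative (\<lambda>s. s *\<^sub>R b)) (at 0)"
    by (auto intro!: derivative_eq_intros)
  have "((\<lambda>t. u (x + t *\<^sub>R b)) has_derivative (\<lambda>s. D (s *\<^sub>R b))) (at 0)"
    by (rule has_derivative_compose[OF p]) (use assms in simp)
  moreover have "D (s *\<^sub>R b) = D b * s" for s
    using linear_scale[OF has_derivative_linear[OF assms]] by simp
  ultimately show ?thesis
    unfolding partial_deriv_def
    by (intro DERIV_imp_deriv has_derivative_imp_has_field_derivative[where D = "\<lambda>s. D (s *\<^sub>R b)"]) auto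
qed

lemma partial_deriv_mult:
  assumes "f differentiable at x" "g differentiable at x"
  shows "partial_deriv b (\<lambda>x. f x * g x) x = f x * partial_deriv b g x + partial_deriv b f x * g x"
proof -
  obtain f' g' where d: "(f has_derivative f') (at x)" "(g has_derivative g') (at x)"
    using assms by (auto simp: differentiable_def)
  show ?thesis
    using partial_deriv_eq[OF has_derivative_mult[OF d]] partial_deriv_eq[OF d(1)]
      partial_deriv_eq[OF d(2)] by simp
qed

lemma partial_deriv_add:
  assumes "f differentiable at x" "g differentiable at x"
  shows "partial_deriv b (\<lambda>x. f x + g x) x = partial_deriv b f x + partial_deriv b g x"
proof -
  obtain f' g' where d: "(f has_derivative f') (at x)" "(g has_derivative g') (at x)"
    using assms by (auto simp: differentiable_def)
  show ?thesis
    using partial_deriv_eq[OF has_derivative_add[OF d]] partial_deriv_eq[OF d(1)]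
      partial_deriv_eq[OF d(2)] by simp
qed

text \<open>
  This algebra of functions serves to show that the first order coefficients of the operator are
  bounded: it contains the entries of the coefficient matrix and is closed under everything that
  the determinant and its real powers are made of.
\<close>

definition bounded_C1_on :: "'a::euclidean_space set \<Rightarrow> ('a \<Rightarrow> real) \<Rightarrow> bool" where
  "bounded_C1_on S f \<longleftrightarrow>
     (\<exists>K. \<forall>x\<in>S. \<bar>f x\<bar> \<le> K \<and> f differentiable (at x) \<and> (\<forall>b\<in>Basis. \<bar>partial_deriv b f x\<bar> \<le> K))"

lemma bounded_C1_on_const: "bounded_C1_on S (\<lambda>x. k)"
proof -
  have "partial_deriv b (\<lambda>x. k) x = 0" for b x :: 'a
    using partial_deriv_eq[OF has_derivative_const] .
  then show ?thesis
    unfolding bounded_C1_on_def by (intro exI[of _ "\<bar>k\<bar>"]) auto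
qed

lemma bounded_C1_on_mult:
  assumes "bounded_C1_on S f" "bounded_C1_on S g"
  shows "bounded_C1_on S (\<lambda>x. f x * g x)"
proof -
  obtain K where K: "\<And>x. x \<in> S \<Longrightarrow> \<bar>f x\<bar> \<le> K" "\<And>x. x \<in> S \<Longrightarrow> f differentiable at x"
    "\<And>x b. x \<in> S \<Longrightarrow> b \<in> Basis \<Longrightarrow> \<bar>partial_deriv b f x\<bar> \<le> K"
    using assms(1) unfolding bounded_C1_on_def by blast
  obtain M where M: "\<And>x. x \<in> S \<Longrightarrow> \<bar>g x\<bar> \<le> M" "\<And>x. x \<in> S \<Longrightarrow> g differentiable at x"
    "\<And>x b. x \<in> S \<Longrightarrow> b \<in> Basis \<Longrightarrow> \<bar>partial_deriv b g x\<bar> \<le> M"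
    using assms(2) unfolding bounded_C1_on_def by blast
  show ?thesis
    unfolding bounded_C1_on_def
  proof (intro exI[of _ "2 * (K * M)"] ballI conjI)
    fix x assume x: "x \<in> S"
    have KM: "0 \<le> K" "0 \<le> M" using K(1)[OF x] M(1)[OF x] by auto
    have le: "\<bar>p * q\<bar> \<le> K * M" if "\<bar>p\<bar> \<le> K" "\<bar>q\<bar> \<le> M" for p q
      using that KM by (simp add: abs_mult mult_mono)
    show "\<bar>f x * g x\<bar> \<le> 2 * (K * M)"
      using le[OF K(1)[OF x] M(1)[OF x]] KM mult_nonneg_nonneg[OF KM] by linarith
    show "(\<lambda>x. f x * g x) differentiable at x"
      using K(2)[OF x] M(2)[OF x] by (rule differentiable_mult)
    fix b :: 'a assume b: "b \<in> Basis"
    show "\<bar>partial_deriv b (\<lambda>x. f x * g x) x\<bar> \<le> 2 * (K * M)"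
      unfolding partial_deriv_mult[OF K(2)[OF x] M(2)[OF x]]
      using le[OF K(1)[OF x] M(3)[OF x b]] le[OF K(3)[OF x b] M(1)[OF x]] by linarith
  qed
qed

lemma bounded_C1_on_add:
  assumes "bounded_C1_on S f" "bounded_C1_on S g"
  shows "bounded_C1_on S (\<lambda>x. f x + g x)"
proof -
  obtain K where K: "\<And>x. x \<in> S \<Longrightarrow> \<bar>f x\<bar> \<le> K" "\<And>x. x \<in> S \<Longrightarrow> f differentiable at x"
    "\<And>x b. x \<in> S \<Longrightarrow> b \<in> Basis \<Longrightarrow> \<bar>partial_deriv b f x\<bar> \<le> K"
    using assms(1) unfolding bounded_C1_on_def by blast
  obtain M where M: "\<And>x. x \<in> S \<Longrightarrow> \<bar>g x\<bar> \<le> M" "\<And>x. x \<in> S \<Longrightarrow> g differentiable at x"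
    "\<And>x b. x \<in> S \<Longrightarrow> b \<in> Basis \<Longrightarrow> \<bar>partial_deriv b g x\<bar> \<le> M"
    using assms(2) unfolding bounded_C1_on_def by blast
  show ?thesis
    unfolding bounded_C1_on_def
  proof (intro exI[of _ "K + M"] ballI conjI)
    fix x assume x: "x \<in> S"
    show "\<bar>f x + g x\<bar> \<le> K + M"
      using K(1)[OF x] M(1)[OF x] by linarith
    show "(\<lambda>x. f x + g x) differentiable at x"
      using K(2)[OF x] M(2)[OF x] by (rule differentiable_add)
    fix b :: 'a assume b: "b \<in> Basis"
    show "\<bar>partial_deriv b (\<lambda>x. f x + g x) x\<bar> \<le> K + M"
      unfolding partial_deriv_add[OF K(2)[OF x] M(2)[OF x]]
      using K(3)[OF x b] M(3)[OF x b] by linarith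
  qed
qed

lemma bounded_C1_on_sum:
  "(\<And>i. i \<in> I \<Longrightarrow> bounded_C1_on S (f i)) \<Longrightarrow> bounded_C1_on S (\<lambda>x. \<Sum>i\<in>I. f i x)"
  by (induction I rule: infinite_finite_induct) (auto intro: bounded_C1_on_const bounded_C1_on_add)

lemma bounded_C1_on_prod:
  "(\<And>i. i \<in> I \<Longrightarrow> bounded_C1_on S (f i)) \<Longrightarrow> bounded_C1_on S (\<lambda>x. \<Prod>i\<in>I. f i x)"
  by (induction I rule: infinite_finite_induct) (auto intro: bounded_C1_on_const bounded_C1_on_mult)

lemma bounded_C1_on_powr:
  assumes f: "bounded_C1_on S f" and d: "0 < d" "\<And>x. x \<in> S \<Longrightarrow> d \<le> f x"
  shows "bounded_C1_on S (\<lambda>x. f x powr p)"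
proof -
  obtain K where K: "\<And>x. x \<in> S \<Longrightarrow> \<bar>f x\<bar> \<le> K" "\<And>x. x \<in> S \<Longrightarrow> f differentiable at x"
    "\<And>x b. x \<in> S \<Longrightarrow> b \<in> Basis \<Longrightarrow> \<bar>partial_deriv b f x\<bar> \<le> K"
    using f unfolding bounded_C1_on_def by blast
  have "bounded ((\<lambda>s. s powr q) ` {d..K})" for q
    using d(1) by (intro compact_imp_bounded compact_continuous_image continuous_intros) auto
  then have "\<exists>M. \<forall>s\<in>{d..K}. \<bar>s powr q\<bar> \<le> M" for q
    by (auto simp: bounded_iff)
  then obtain M where M: "\<And>q s. s \<in> {d..K} \<Longrightarrow> \<bar>s powr q\<bar> \<le> M q" by metis
  show ?thesis
    unfolding bounded_C1_on_def
  proof (intro exI[of _ "M p + \<bar>p\<bar> * M (p - 1) * K"] ballI conjI)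
    fix x assume x: "x \<in> S"
    have fx: "f x \<in> {d..K}" "0 < f x" using d(1) d(2)[OF x] K(1)[OF x] by auto
    have nn: "0 \<le> K" "0 \<le> M p" "0 \<le> M (p - 1)"
      using order_trans[OF abs_ge_zero M[OF fx(1)]] order_trans[OF abs_ge_zero K(1)[OF x]] by auto
    then have nn': "0 \<le> \<bar>p\<bar> * M (p - 1) * K" by simp
    show "\<bar>f x powr p\<bar> \<le> M p + \<bar>p\<bar> * M (p - 1) * K" using M[OF fx(1), of p] nn' by linarith
    obtain f' where f': "(f has_derivative f') (at x)" using K(2)[OF x] by (auto simp: differentiable_def)
    have "((\<lambda>s. s powr p) has_real_derivative p * f x powr (p - 1)) (at (f x))"
      using fx(2) by (rule has_real_derivative_powr)
    then have "((\<lambda>s. s powr p) has_derivative (\<lambda>h. p * f x powr (p - 1) * h)) (at (f x))"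
      by (simp add: has_field_derivative_def)
    from has_derivative_compose[OF f' this]
    have D: "((\<lambda>x. f x powr p) has_derivative (\<lambda>h. p * f x powr (p - 1) * f' h)) (at x)" .
    then show "(\<lambda>x. f x powr p) differentiable at x" by (auto simp: differentiable_def)
    fix b :: 'a assume b: "b \<in> Basis"
    have "\<bar>partial_deriv b (\<lambda>x. f x powr p) x\<bar> = \<bar>p\<bar> * \<bar>f x powr (p - 1)\<bar> * \<bar>partial_deriv b f x\<bar>"
      by (simp add: partial_deriv_eq[OF D] partial_deriv_eq[OF f'] abs_mult)
    also have "\<dots> \<le> \<bar>p\<bar> * M (p - 1) * K"
      using K(3)[OF x b] M[OF fx(1), of "p - 1"] nn by (intro mult_mono) auto
    finally show "\<bar>partial_deriv b (\<lambda>x. f x powr p) x\<bar> \<le> M p + \<bar>p\<bar> * M (p - 1) * K"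
      using nn by linarith
  qed
qed

lemma C_upto_imp_continuous_on: "C_upto k S u \<Longrightarrow> continuous_on (closure S) u"
  by (cases k) auto

lemma C_upto_partial_derivE:
  assumes "C_upto (Suc k) S u" "b \<in> Basis"
  obtains v where "\<And>x. x \<in> S \<Longrightarrow> v x = partial_deriv b u x" "C_upto k S v"
  using assms by (simp only: C_upto.simps) blast

lemma C_upto_imp_bounded_C1_on:
  assumes u: "C_upto (Suc k) S u" and T: "bounded T" "T \<subseteq> S"
  shows "bounded_C1_on T u"
proof -
  have bd: "\<exists>K. \<forall>x\<in>T. \<bar>v x\<bar> \<le> K" if "continuous_on (closure S) v" for v :: "'a \<Rightarrow> real"
  proof -
    have "compact (v ` closure T)"
      using T closure_mono by (intro compact_continuous_image continuous_on_subset[OF that]) auto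
    then have "bounded (v ` closure T)" by (rule compact_imp_bounded)
    then obtain K where "\<forall>s\<in>v ` closure T. norm s \<le> K"
      unfolding bounded_iff by blast
    then show ?thesis using closure_subset[of T] by (intro exI[of _ K]) auto
  qed
  have "\<exists>K. \<forall>x\<in>T. \<bar>partial_deriv b u x\<bar> \<le> K" if b: "b \<in> Basis" for b
  proof -
    obtain v where v: "\<And>x. x \<in> S \<Longrightarrow> v x = partial_deriv b u x" "C_upto k S v"
      by (rule C_upto_partial_derivE[OF u b]) (rule that)
    show ?thesis using bd[OF C_upto_imp_continuous_on[OF v(2)]] v(1) T(2) by (metis subsetD)
  qed
  then obtain K where K: "\<And>b x. b \<in> Basis \<Longrightarrow> x \<in> T \<Longrightarrow> \<bar>partial_deriv b u x\<bar> \<le> K b"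
    by metis
  obtain K0 where K0: "\<And>x. x \<in> T \<Longrightarrow> \<bar>u x\<bar> \<le> K0"
    using bd[OF C_upto_imp_continuous_on[OF u]] by blast
  show ?thesis
    unfolding bounded_C1_on_def
  proof (intro exI[of _ "\<bar>K0\<bar> + (\<Sum>b\<in>Basis. \<bar>K b\<bar>)"] ballI conjI)
    fix x assume x: "x \<in> T"
    have "0 \<le> (\<Sum>b\<in>Basis. \<bar>K b\<bar>)" by (simp add: sum_nonneg)
    then show "\<bar>u x\<bar> \<le> \<bar>K0\<bar> + (\<Sum>b\<in>Basis. \<bar>K b\<bar>)" using K0[OF x] by linarith
    show "u differentiable at x" using u x T by auto
    fix b :: 'a assume b: "b \<in> Basis"
    have "\<bar>K b\<bar> \<le> (\<Sum>b\<in>Basis. \<bar>K b\<bar>)" using b by (intro member_le_sum) auto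
    then show "\<bar>partial_deriv b u x\<bar> \<le> \<bar>K0\<bar> + (\<Sum>b\<in>Basis. \<bar>K b\<bar>)"
      using K[OF b x] by linarith
  qed
qed

text \<open>
  Derivatives extend continuously to the closure, so the limits in the conormal derivative exist.
\<close>

lemma C_upto_partial_deriv_limit:
  assumes u: "C_upto (Suc k) S u" and b: "b \<in> Basis" and x: "x \<in> closure S"
  obtains l where "(partial_deriv b u \<longlongrightarrow> l) (at x within S)"
proof -
  obtain v where v: "\<And>x. x \<in> S \<Longrightarrow> v x = partial_deriv b u x" "C_upto k S v"
    by (rule C_upto_partial_derivE[OF u b]) (rule that)
  have "(v \<longlongrightarrow> v x) (at x within closure S)"
    using C_upto_imp_continuous_on[OF v(2)] x by (simp add: continuous_on_def)
  then have "(v \<longlongrightarrow> v x) (at x within S)"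
    using closure_subset by (rule tendsto_within_subset)
  moreover have "eventually (\<lambda>z. v z = partial_deriv b u z) (at x within S)"
    using v(1) by (auto simp: eventually_at_filter)
  ultimately show thesis using that tendsto_cong by metis
qed

definition grad :: "(real^'n \<Rightarrow> real) \<Rightarrow> real^'n \<Rightarrow> real^'n" where
  "grad u x = (\<chi> k. partial_deriv (axis k 1) u x)"

definition hess :: "(real^'n \<Rightarrow> real) \<Rightarrow> real^'n \<Rightarrow> real^'n^'n" where
  "hess u x = (\<chi> k i. partial_deriv (axis i 1) (partial_deriv (axis k 1) u) x)"

lemma axis_Basis: "axis k 1 \<in> (Basis :: (real^'n) set)"
  by (simp add: axis_in_Basis_iff)

lemma has_derivative_partial_deriv_axis:
  fixes u :: "real^'n \<Rightarrow> real"
  assumes "u differentiable at x"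
  shows "(u has_derivative (\<lambda>h. \<Sum>k\<in>UNIV. partial_deriv (axis k 1) u x * h $ k)) (at x)"
proof -
  obtain D where D: "(u has_derivative D) (at x)" using assms by (auto simp: differentiable_def)
  have "D h = (\<Sum>k\<in>UNIV. partial_deriv (axis k 1) u x * h $ k)" for h
  proof -
    have lin: "linear D" by (rule has_derivative_linear[OF D])
    have "D h = D (\<Sum>k\<in>UNIV. h $ k *\<^sub>R axis k 1)"
      using basis_expansion[of h] by (simp add: scalar_mult_eq_scaleR)
    also have "\<dots> = (\<Sum>k\<in>UNIV. h $ k * D (axis k 1))"
      by (simp add: linear_sum[OF lin] linear_scale[OF lin])
    finally show ?thesis by (simp add: partial_deriv_eq[OF D] mult.commute)
  qed
  then have "D = (\<lambda>h. \<Sum>k\<in>UNIV. partial_deriv (axis k 1) u x * h $ k)" by (rule ext)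
  with D show ?thesis by simp
qed

lemma C_upto_2_partial_differentiable:
  assumes "C_upto 2 S u" "open S" "x \<in> S" "b \<in> Basis"
  shows "partial_deriv b u differentiable at x"
proof -
  obtain v where v: "\<And>x. x \<in> S \<Longrightarrow> v x = partial_deriv b u x" "C_upto 1 S v"
    by (rule C_upto_partial_derivE[OF assms(1)[folded Suc_1] assms(4)]) (rule that)
  then obtain D where "(v has_derivative D) (at x)"
    using assms(3) by (auto simp: differentiable_def)
  then have "(partial_deriv b u has_derivative D) (at x)"
    using assms(2,3) v(1) by (rule has_derivative_transform_within_open)
  then show ?thesis by (auto simp: differentiable_def)
qed

lemma C_upto_2_has_grad_hess_on:
  fixes u :: "real^'n \<Rightarrow> real"
  assumes u: "C_upto 2 S u" and S: "open S"
  shows "has_grad_hess_on u (grad u) (hess u) S"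
  unfolding has_grad_hess_on_def
proof (intro ballI conjI)
  fix x assume x: "x \<in> S"
  have "u differentiable at x" using u x by (auto simp: numeral_2_eq_2)
  from has_derivative_partial_deriv_axis[OF this]
  show "(u has_derivative (\<lambda>h. grad u x \<bullet> h)) (at x)"
    by (simp add: grad_def inner_vec_def)
  have "((\<lambda>y. grad u y \<bullet> axis k 1) has_derivative (\<lambda>h. (hess u x *v h) \<bullet> axis k 1)) (at x)" for k
    using has_derivative_partial_deriv_axis[OF C_upto_2_partial_differentiable[OF u S x axis_Basis[of k]]]
    by (simp add: grad_def hess_def inner_axis matrix_vector_mult_def)
  then show "(grad u has_derivative (\<lambda>h. hess u x *v h)) (at x)"
    by (subst has_derivative_componentwise_within) (auto simp: Basis_vec_def)
qed

lemma hess_bounded: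
  fixes u :: "real^'n \<Rightarrow> real"
  assumes u: "C_upto 2 S u" and S: "open S" "bounded S"
  obtains K where "0 \<le> K" "\<And>x h. x \<in> S \<Longrightarrow> norm (hess u x *v h) \<le> K * norm h"
proof -
  have "\<exists>K. \<forall>x\<in>S. \<forall>i. \<bar>hess u x $ k $ i\<bar> \<le> K" for k
  proof -
    obtain v where v: "\<And>x. x \<in> S \<Longrightarrow> v x = partial_deriv (axis k 1) u x" "C_upto (Suc 0) S v"
      by (rule C_upto_partial_derivE[OF u[unfolded numeral_2_eq_2] axis_Basis[of k]]) (rule that)
    obtain K where K: "\<And>x i. x \<in> S \<Longrightarrow> \<bar>partial_deriv (axis i 1) v x\<bar> \<le> K"
      using C_upto_imp_bounded_C1_on[OF v(2) S(2) order_refl] axis_Basis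
      unfolding bounded_C1_on_def by metis
    have "partial_deriv (axis i 1) v x = hess u x $ k $ i" if x: "x \<in> S" for x i
    proof -
      obtain D where D: "(v has_derivative D) (at x)"
        using v(2) x by (auto simp: differentiable_def)
      then have "(partial_deriv (axis k 1) u has_derivative D) (at x)"
        using S(1) x v(1) by (rule has_derivative_transform_within_open)
      with D show ?thesis by (simp add: hess_def partial_deriv_eq)
    qed
    with K show ?thesis by metis
  qed
  then obtain K where K: "\<And>k x i. x \<in> S \<Longrightarrow> \<bar>hess u x $ k $ i\<bar> \<le> K k" by metis
  define M where "M = (\<Sum>k\<in>(UNIV::'n set). \<Sum>i\<in>(UNIV::'n set). \<bar>K k\<bar>)"
  show thesis
  proof
    show "0 \<le> M" by (simp add: M_def sum_nonneg)
    fix x h assume x: "x \<in> S"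
    have "norm (hess u x *v h) \<le> (\<Sum>k\<in>UNIV. \<bar>(hess u x *v h) $ k\<bar>)" by (rule norm_le_l1_cart)
    also have "\<dots> \<le> (\<Sum>k\<in>UNIV. \<Sum>i\<in>(UNIV::'n set). \<bar>K k\<bar> * norm h)"
    proof (intro sum_mono)
      fix k
      have "\<bar>(hess u x *v h) $ k\<bar> \<le> (\<Sum>i\<in>UNIV. \<bar>hess u x $ k $ i * h $ i\<bar>)"
        unfolding matrix_vector_mult_def by simp
      also have "\<dots> \<le> (\<Sum>i\<in>(UNIV::'n set). \<bar>K k\<bar> * norm h)"
        unfolding abs_mult
      proof (intro sum_mono mult_mono)
        show "\<bar>hess u x $ k $ i\<bar> \<le> \<bar>K k\<bar>" for i using K[OF x, of k i] by linarith
      qed (auto intro: component_le_norm_cart)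
      finally show "\<bar>(hess u x *v h) $ k\<bar> \<le> (\<Sum>i\<in>(UNIV::'n set). \<bar>K k\<bar> * norm h)" .
    qed
    also have "\<dots> = M * norm h" by (simp add: M_def sum_distrib_right mult.assoc)
    finally show "norm (hess u x *v h) \<le> M * norm h" .
  qed
qed

section \<open>The nondivergence form of the operator\<close>

definition flux_coeff :: "(real^'n \<Rightarrow> real^'n^'n) \<Rightarrow> 'n \<Rightarrow> 'n \<Rightarrow> real^'n \<Rightarrow> real" where
  "flux_coeff a i k x = \<bar>det (a x)\<bar> powr (-1/2) * a x $ i $ k"

text \<open>
  The first order coefficients that appear when the divergence is carried out.
\<close>

definition drift :: "(real^'n \<Rightarrow> real^'n^'n) \<Rightarrow> real^'n \<Rightarrow> real^'n" where
  "drift a x = (\<chi> k. \<bar>det (a x)\<bar> powr (1/2) * (\<Sum>i\<in>UNIV. partial_deriv (axis i 1) (flux_coeff a i k) x))"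

lemma div_op_nondivergence:
  fixes a :: "real^'n \<Rightarrow> real^'n^'n"
  assumes u: "C_upto 2 \<Omega> u" and \<Omega>: "open \<Omega>" "x \<in> \<Omega>" and det: "det (a x) \<noteq> 0"
    and diff: "\<And>i k. flux_coeff a i k differentiable at x"
  shows "div_op a u x = - (trace (a x ** hess u x) + drift a x \<bullet> grad u x)"
proof -
  let ?P = "\<bar>det (a x)\<bar> powr (1/2)"
  have P: "?P * flux_coeff a i k x = a x $ i $ k" for i k
  proof -
    have "?P * \<bar>det (a x)\<bar> powr (-1/2) = 1" using det by (simp flip: powr_add)
    then show ?thesis by (simp add: flux_coeff_def flip: mult.assoc)
  qed
  have "partial_deriv (axis i 1) (\<lambda>y. flux_coeff a i k y * partial_deriv (axis k 1) u y) x
      = flux_coeff a i k x * hess u x $ k $ i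
        + partial_deriv (axis i 1) (flux_coeff a i k) x * grad u x $ k" for i k
    by (subst partial_deriv_mult[OF diff C_upto_2_partial_differentiable[OF u \<Omega> axis_Basis]])
      (simp add: hess_def grad_def)
  then have "div_op a u x = - (?P * (\<Sum>i\<in>UNIV. \<Sum>k\<in>UNIV. flux_coeff a i k x * hess u x $ k $ i
        + partial_deriv (axis i 1) (flux_coeff a i k) x * grad u x $ k))"
    unfolding div_op_def flux_coeff_def[symmetric] by simp
  also have "\<dots> = - ((\<Sum>i\<in>UNIV. \<Sum>k\<in>UNIV. ?P * flux_coeff a i k x * hess u x $ k $ i)
      + (\<Sum>k\<in>UNIV. \<Sum>i\<in>UNIV. ?P * partial_deriv (axis i 1) (flux_coeff a i k) x * grad u x $ k))"
    by (subst (2) sum.swap) (simp add: sum_distrib_left distrib_left sum.distrib mult.assoc)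
  also have "(\<Sum>i\<in>UNIV. \<Sum>k\<in>UNIV. ?P * flux_coeff a i k x * hess u x $ k $ i)
      = trace (a x ** hess u x)"
    by (simp add: P trace_def matrix_matrix_mult_def)
  also have "(\<Sum>k\<in>UNIV. \<Sum>i\<in>UNIV. ?P * partial_deriv (axis i 1) (flux_coeff a i k) x * grad u x $ k)
      = drift a x \<bullet> grad u x"
    by (simp add: drift_def inner_vec_def sum_distrib_left sum_distrib_right mult_ac)
  finally show ?thesis .
qed

lemma elliptic_onE:
  assumes "elliptic_on S a"
  obtains c where "c > 0" "\<And>x \<xi>. x \<in> S \<Longrightarrow> c * (norm \<xi>)\<^sup>2 \<le> \<xi> \<bullet> (a x *v \<xi>)"
  using assms unfolding elliptic_on_def quadratic_form_sum[symmetric] by blast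

text \<open>
  By ellipticity the determinant has no zero on the compact closure, hence its square is bounded away
  from zero. Writing \<open>\<bar>det\<bar> powr p\<close> as \<open>(det\<^sup>2) powr (p / 2)\<close> avoids the absolute value when
  differentiating.
\<close>

lemma elliptic_coefficients_bounded:
  fixes a :: "real^'n \<Rightarrow> real^'n^'n"
  assumes bdd: "bounded \<Omega>"
    and a_C1: "\<And>i j. C_upto (Suc k) \<Omega> (\<lambda>x. a x $ i $ j)"
    and ell: "elliptic_on (closure \<Omega>) a"
  obtains \<Lambda> where "\<And>x. x \<in> \<Omega> \<Longrightarrow> det (a x) \<noteq> 0"
    "\<And>x i k. x \<in> \<Omega> \<Longrightarrow> flux_coeff a i k differentiable at x"
    "\<And>x. x \<in> \<Omega> \<Longrightarrow> trace (a x) \<le> \<Lambda>" "\<And>x. x \<in> \<Omega> \<Longrightarrow> norm (drift a x) \<le> \<Lambda>"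
proof -
  obtain c where c: "c > 0" "\<And>x \<xi>. x \<in> closure \<Omega> \<Longrightarrow> c * (norm \<xi>)\<^sup>2 \<le> \<xi> \<bullet> (a x *v \<xi>)"
    by (rule elliptic_onE[OF ell]) (rule that)
  have det: "det (a x) \<noteq> 0" if "x \<in> closure \<Omega>" for x
  proof -
    have "\<xi> = 0" if "a x *v \<xi> = 0" for \<xi>
      using c(2)[OF \<open>x \<in> closure \<Omega>\<close>, of \<xi>] c(1) that by (simp add: mult_le_0_iff)
    then have "invertible (a x)"
      unfolding invertible_left_inverse matrix_left_invertible_ker by blast
    then show ?thesis by (simp add: invertible_det_nz)
  qed
  have a_bd: "bounded_C1_on \<Omega> (\<lambda>x. a x $ i $ j)" for i j
    by (rule C_upto_imp_bounded_C1_on[OF a_C1 bdd order_refl])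
  have "bounded_C1_on \<Omega> (\<lambda>x. det (a x))"
    unfolding det_def
    by (intro bounded_C1_on_sum bounded_C1_on_mult bounded_C1_on_prod bounded_C1_on_const a_bd)
  then have det2: "bounded_C1_on \<Omega> (\<lambda>x. (det (a x))\<^sup>2)"
    unfolding power2_eq_square by (intro bounded_C1_on_mult)
  have "\<exists>d>0. \<forall>x\<in>\<Omega>. d \<le> (det (a x))\<^sup>2"
  proof (cases "\<Omega> = {}")
    case False
    have "continuous_on (closure \<Omega>) (\<lambda>x. (det (a x))\<^sup>2)"
      unfolding det_def using C_upto_imp_continuous_on[OF a_C1]
      by (intro continuous_on_power continuous_on_sum continuous_on_mult continuous_on_const
          continuous_on_prod)
    moreover have "compact (closure \<Omega>)" "closure \<Omega> \<noteq> {}" using bdd False by auto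
    ultimately obtain q where "q \<in> closure \<Omega>" "\<forall>x\<in>closure \<Omega>. (det (a q))\<^sup>2 \<le> (det (a x))\<^sup>2"
      using continuous_attains_inf by blast
    then show ?thesis using det closure_subset by (intro exI[of _ "(det (a q))\<^sup>2"]) auto
  qed (auto intro: exI[of _ 1])
  then obtain d where d: "0 < d" "\<And>x. x \<in> \<Omega> \<Longrightarrow> d \<le> (det (a x))\<^sup>2" by blast
  have powr_bd: "bounded_C1_on \<Omega> (\<lambda>x. \<bar>det (a x)\<bar> powr p)" for p
  proof -
    have "\<bar>s\<bar> powr p = (s\<^sup>2) powr (p / 2)" for s :: real
    proof (cases "s = 0")
      case False
      then have "s\<^sup>2 = \<bar>s\<bar> powr 2" by (simp add: powr_numeral)
      then show ?thesis by (simp only: powr_powr) simp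
    qed simp
    then show ?thesis using bounded_C1_on_powr[OF det2 d] by simp
  qed
  have flux: "bounded_C1_on \<Omega> (flux_coeff a i k)" for i k
    unfolding flux_coeff_def[abs_def] by (intro bounded_C1_on_mult powr_bd a_bd)
  obtain KF where KF: "\<And>i k x. x \<in> \<Omega> \<Longrightarrow> flux_coeff a i k differentiable at x"
    "\<And>i k x b. x \<in> \<Omega> \<Longrightarrow> b \<in> Basis \<Longrightarrow> \<bar>partial_deriv b (flux_coeff a i k) x\<bar> \<le> KF i k"
    using flux unfolding bounded_C1_on_def by metis
  obtain KP where KP: "\<And>x. x \<in> \<Omega> \<Longrightarrow> \<bar>\<bar>det (a x)\<bar> powr (1/2)\<bar> \<le> KP"
    using powr_bd[of "1/2"] unfolding bounded_C1_on_def by metis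
  have "bounded_C1_on \<Omega> (\<lambda>x. trace (a x))"
    unfolding trace_def by (intro bounded_C1_on_sum a_bd)
  then obtain KT where KT: "\<And>x. x \<in> \<Omega> \<Longrightarrow> \<bar>trace (a x)\<bar> \<le> KT"
    unfolding bounded_C1_on_def by metis
  define KB where "KB = (\<Sum>k\<in>UNIV. KP * (\<Sum>i\<in>UNIV. KF i k))"
  have drift: "norm (drift a x) \<le> KB" if x: "x \<in> \<Omega>" for x
  proof -
    have "norm (drift a x) \<le> (\<Sum>k\<in>UNIV. \<bar>drift a x $ k\<bar>)" by (rule norm_le_l1_cart)
    also have "\<dots> \<le> KB"
      unfolding KB_def
    proof (intro sum_mono)
      fix k
      have "\<bar>drift a x $ k\<bar> = \<bar>\<bar>det (a x)\<bar> powr (1/2)\<bar>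
          * \<bar>\<Sum>i\<in>UNIV. partial_deriv (axis i 1) (flux_coeff a i k) x\<bar>"
        by (simp add: drift_def abs_mult)
      also have "\<dots> \<le> KP * (\<Sum>i\<in>UNIV. KF i k)"
      proof (intro mult_mono KP x)
        show "\<bar>\<Sum>i\<in>UNIV. partial_deriv (axis i 1) (flux_coeff a i k) x\<bar> \<le> (\<Sum>i\<in>UNIV. KF i k)"
          by (rule order_trans[OF sum_abs]) (intro sum_mono KF(2) x axis_Basis)
        show "0 \<le> KP" using KP[OF x] by linarith
      qed auto
      finally show "\<bar>drift a x $ k\<bar> \<le> KP * (\<Sum>i\<in>UNIV. KF i k)" .
    qed
    finally show ?thesis .
  qed
  show thesis
  proof (rule that[of "\<bar>KT\<bar> + \<bar>KB\<bar>"])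
    fix x assume x: "x \<in> \<Omega>"
    show "det (a x) \<noteq> 0" using det closure_subset x by blast
    show "flux_coeff a i k differentiable at x" for i k by (rule KF(1)[OF x])
    show "trace (a x) \<le> \<bar>KT\<bar> + \<bar>KB\<bar>" using KT[OF x] by linarith
    show "norm (drift a x) \<le> \<bar>KT\<bar> + \<bar>KB\<bar>" using drift[OF x] by linarith
  qed
qed

section \<open>The interior ball condition\<close>

lemma mem_frontier_above_graph:
  assumes chart: "graph_chart k \<alpha> S x0 r e \<gamma>" and z: "z \<in> ball x0 r" "\<gamma> z = z \<bullet> e"
  shows "z \<in> frontier S"
proof -
  have e: "norm e = 1" and inv: "\<And>y t. \<gamma> (y + t *\<^sub>R e) = \<gamma> y"
    and S: "S \<inter> ball x0 r = {x \<in> ball x0 r. \<gamma> x < x \<bullet> e}"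
    using chart by (auto simp: graph_chart_def)
  have "\<exists>y\<in>S. dist y z < \<epsilon>" if "\<epsilon> > 0" for \<epsilon>
  proof -
    define t where "t = min \<epsilon> (r - dist x0 z) / 2"
    have t: "0 < t" "t < \<epsilon>" "dist x0 z + t < r"
      using that z(1) by (auto simp: t_def min_def field_simps)
    have d: "dist (z + t *\<^sub>R e) z = t" using t(1) e by (simp add: dist_norm)
    have "z + t *\<^sub>R e \<in> ball x0 r"
      using dist_triangle[of x0 "z + t *\<^sub>R e" z] d t(3) by (simp add: dist_commute)
    moreover have "\<gamma> (z + t *\<^sub>R e) < (z + t *\<^sub>R e) \<bullet> e"
      using inv z(2) e t(1) by (simp add: inner_add_left norm_eq_1)
    ultimately have "z + t *\<^sub>R e \<in> S" using S by blast
    then show ?thesis using d t(2) by (intro bexI[of _ "z + t *\<^sub>R e"]) auto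
  qed
  then have "z \<in> closure S" by (simp add: closure_approachable)
  moreover have "z \<notin> S" using S z by (metis (no_types, lifting) IntI less_irrefl mem_Collect_eq)
  ultimately show ?thesis using interior_subset[of S] by (auto simp: frontier_def)
qed

lemma frontier_mem_graph:
  assumes chart: "graph_chart k \<alpha> S x0 r e \<gamma>" and S: "open S" "x0 \<in> frontier S"
    and cont: "isCont \<gamma> x0"
  shows "\<gamma> x0 = x0 \<bullet> e"
proof (rule ccontr)
  assume neq: "\<gamma> x0 \<noteq> x0 \<bullet> e"
  have r: "r > 0" and SB: "S \<inter> ball x0 r = {x \<in> ball x0 r. \<gamma> x < x \<bullet> e}"
    using chart by (auto simp: graph_chart_def)
  have x0: "x0 \<in> closure S" "x0 \<notin> S"
    using S by (auto simp: frontier_def interior_open)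
  then have pos: "0 < \<gamma> x0 - x0 \<bullet> e" using SB r neq by force
  have "isCont (\<lambda>x. \<gamma> x - x \<bullet> e) x0" by (intro continuous_intros cont)
  then have "((\<lambda>x. \<gamma> x - x \<bullet> e) \<longlongrightarrow> \<gamma> x0 - x0 \<bullet> e) (nhds x0)"
    using tendsto_at_iff_tendsto_nhds[of "\<lambda>x. \<gamma> x - x \<bullet> e" x0] by (simp add: isCont_def)
  from order_tendstoD(1)[OF this pos] obtain d where d: "d > 0" "\<And>x. dist x x0 < d \<Longrightarrow> 0 < \<gamma> x - x \<bullet> e"
    by (auto simp: eventually_nhds_metric)
  obtain z where "z \<in> S" "dist z x0 < min d r"
    using x0(1) d(1) r by (metis closure_approachable min_less_iff_conj)
  then have "z \<in> S \<inter> ball x0 r" "0 < \<gamma> z - z \<bullet> e" using d(2) by (auto simp: dist_commute)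
  then show False using SB by auto
qed

text \<open>
  The curve \<open>s \<mapsto> x0 + s v + (\<gamma> (x0 + s v) - \<gamma> x0) e\<close> runs in the boundary and has velocity
  \<open>v + (g \<bullet> v) e\<close> at \<open>x0\<close>; the limit in the definition of the normal is evaluated along it.
\<close>

lemma normal_orthogonal_to_tangent:
  fixes \<gamma> :: "real^'n \<Rightarrow> real"
  assumes chart: "graph_chart k \<alpha> S x0 r e \<gamma>" and x0: "\<gamma> x0 = x0 \<bullet> e"
    and d\<gamma>: "(\<gamma> has_derivative (\<lambda>h. g \<bullet> h)) (at x0)"
    and normal: "outward_unit_normal S x0 \<nu>"
    and v: "v \<bullet> e = 0"
  shows "(v + (g \<bullet> v) *\<^sub>R e) \<bullet> \<nu> = 0"
proof (cases "v = 0")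
  case False
  have r: "r > 0" and e: "norm e = 1" and inv: "\<And>y t. \<gamma> (y + t *\<^sub>R e) = \<gamma> y"
    using chart by (auto simp: graph_chart_def)
  let ?T = "v + (g \<bullet> v) *\<^sub>R e"
  define q where "q s = (\<gamma> (x0 + s *\<^sub>R v) - \<gamma> x0) / s" for s :: real
  define Q where "Q s = v + q s *\<^sub>R e" for s
  define y where "y s = x0 + s *\<^sub>R Q s" for s
  have p: "((\<lambda>s. x0 + s *\<^sub>R v) has_derivative (\<lambda>s. s *\<^sub>R v)) (at 0)"
    by (auto intro!: derivative_eq_intros)
  have "((\<lambda>s. \<gamma> (x0 + s *\<^sub>R v)) has_derivative (\<lambda>s. g \<bullet> (s *\<^sub>R v))) (at 0)"
    by (rule has_derivative_compose[OF p]) (use d\<gamma> in simp)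
  then have "((\<lambda>s. \<gamma> (x0 + s *\<^sub>R v)) has_real_derivative g \<bullet> v) (at 0)"
    by (rule has_derivative_imp_has_field_derivative) simp
  then have "(q \<longlongrightarrow> g \<bullet> v) (at 0)"
    by (simp add: has_field_derivative_iff q_def[abs_def])
  then have q: "(q \<longlongrightarrow> g \<bullet> v) (at_right 0)"
    by (rule tendsto_within_subset) simp
  then have Q: "(Q \<longlongrightarrow> ?T) (at_right 0)"
    unfolding Q_def[abs_def] by (intro tendsto_intros)
  have nz: "Q s \<noteq> 0" "?T \<noteq> 0" for s
  proof -
    have "Q s \<bullet> v = v \<bullet> v" "?T \<bullet> v = v \<bullet> v"
      using v by (simp_all add: Q_def inner_add_left inner_add_right inner_commute)
    then show "Q s \<noteq> 0" "?T \<noteq> 0" using False by auto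
  qed
  have "((\<lambda>s. x0 + s *\<^sub>R Q s) \<longlongrightarrow> x0 + 0 *\<^sub>R ?T) (at_right 0)"
    by (intro tendsto_intros Q)
  then have ylim: "(y \<longlongrightarrow> x0) (at_right 0)" by (simp add: y_def[abs_def])
  have "\<forall>\<^sub>F s in at_right 0. y s \<in> ball x0 r"
    using ylim r by (intro topological_tendstoD) auto
  moreover have spos: "\<forall>\<^sub>F s in at_right (0::real). 0 < s"
    by (simp add: eventually_at_right_less)
  ultimately have "\<forall>\<^sub>F s in at_right 0. y s \<in> frontier S \<and> y s \<noteq> x0"
  proof eventually_elim
    case (elim s)
    have "y s = (x0 + s *\<^sub>R v) + (s * q s) *\<^sub>R e"
      by (simp add: y_def Q_def algebra_simps)
    moreover have "s * q s = \<gamma> (x0 + s *\<^sub>R v) - \<gamma> x0" using elim(2) by (simp add: q_def)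
    ultimately have "\<gamma> (y s) = y s \<bullet> e"
      using inv v x0 e by (simp add: inner_add_left norm_eq_1)
    then have "y s \<in> frontier S" using mem_frontier_above_graph[OF chart elim(1)] by simp
    then show ?case using nz(1) elim(2) by (simp add: y_def)
  qed
  then have "filterlim y (at x0 within frontier S) (at_right 0)"
    using ylim by (simp add: filterlim_at)
  then have "((\<lambda>s. (y s - x0) \<bullet> \<nu> / norm (y s - x0)) \<longlongrightarrow> 0) (at_right 0)"
    using normal by (auto simp: outward_unit_normal_def intro: filterlim_compose)
  moreover have "\<forall>\<^sub>F s in at_right 0. (y s - x0) \<bullet> \<nu> / norm (y s - x0) = Q s \<bullet> \<nu> / norm (Q s)"
    using spos by eventually_elim (simp add: y_def)
  ultimately have "((\<lambda>s. Q s \<bullet> \<nu> / norm (Q s)) \<longlongrightarrow> 0) (at_right 0)"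
    by (rule Lim_transform_eventually)
  moreover have "((\<lambda>s. Q s \<bullet> \<nu> / norm (Q s)) \<longlongrightarrow> ?T \<bullet> \<nu> / norm ?T) (at_right 0)"
    using nz by (intro tendsto_intros Q) auto
  ultimately have "?T \<bullet> \<nu> / norm ?T = 0"
    by (intro tendsto_unique[OF _ _ ]) auto
  then show ?thesis using nz(2) by simp
qed simp

text \<open>
  The vector \<open>e - g\<close> is orthogonal to all tangent directions of the graph, and so is \<open>\<nu>\<close>; hence they
  are parallel. The sign is determined by the fact that \<open>- \<nu>\<close> points into the region above the
  graph.
\<close>

lemma graph_chart_normal:
  fixes \<gamma> :: "real^'n \<Rightarrow> real"
  assumes chart: "graph_chart k \<alpha> S x0 r e \<gamma>" and x0: "\<gamma> x0 = x0 \<bullet> e"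
    and d\<gamma>: "(\<gamma> has_derivative (\<lambda>h. g \<bullet> h)) (at x0)"
    and normal: "outward_unit_normal S x0 \<nu>"
  shows "g \<bullet> e = 0" "e - g = - norm (e - g) *\<^sub>R \<nu>"
proof -
  have r: "r > 0" and e: "norm e = 1" and inv: "\<And>y t. \<gamma> (y + t *\<^sub>R e) = \<gamma> y"
    and SB: "S \<inter> ball x0 r = {x \<in> ball x0 r. \<gamma> x < x \<bullet> e}"
    using chart by (auto simp: graph_chart_def)
  have ee: "e \<bullet> e = 1" using e by (simp add: norm_eq_1)
  have "partial_deriv e \<gamma> x0 = 0" unfolding partial_deriv_def inv by simp
  then show ge: "g \<bullet> e = 0" using partial_deriv_eq[OF d\<gamma>] by simp
  define N where "N = e - g"
  \<comment> \<open>the deviation of \<open>\<nu>\<close> from the multiple of \<open>N\<close> with the same component along \<open>e\<close>; being orthogonal to its own lift to the tangent space, it vanishes\<close>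
  define z where "z = \<nu> - (\<nu> \<bullet> e) *\<^sub>R N"
  have Ne: "N \<bullet> e = 1" using ge ee by (simp add: N_def inner_diff_left)
  have ze: "z \<bullet> e = 0" using Ne by (simp add: z_def inner_diff_left)
  let ?T = "z + (g \<bullet> z) *\<^sub>R e"
  have "?T \<bullet> \<nu> = 0" by (rule normal_orthogonal_to_tangent[OF chart x0 d\<gamma> normal ze])
  moreover have "?T \<bullet> N = 0"
    unfolding N_def inner_add_left inner_diff_right inner_scaleR_left
    using ze ge ee by (simp add: inner_commute)
  ultimately have "?T \<bullet> z = 0"
    by (simp only: z_def inner_diff_right inner_scaleR_right)
  then have "z \<bullet> z = 0"
    using ze by (simp only: inner_add_left inner_scaleR_left inner_commute[of e z])
  then have "\<nu> = (\<nu> \<bullet> e) *\<^sub>R N" by (simp add: z_def)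
  then obtain \<kappa> where \<nu>: "\<nu> = \<kappa> *\<^sub>R N" by blast
  have \<nu>1: "norm \<nu> = 1" using normal by (simp add: outward_unit_normal_def)
  have p: "((\<lambda>t. x0 - t *\<^sub>R \<nu>) has_derivative (\<lambda>s. - (s *\<^sub>R \<nu>))) (at 0)"
    by (auto intro!: derivative_eq_intros)
  have "((\<lambda>t. \<gamma> (x0 - t *\<^sub>R \<nu>)) has_derivative (\<lambda>s. g \<bullet> - (s *\<^sub>R \<nu>))) (at 0)"
    by (rule has_derivative_compose[OF p]) (use d\<gamma> in simp)
  then have "((\<lambda>t. \<gamma> (x0 - t *\<^sub>R \<nu>)) has_real_derivative - (g \<bullet> \<nu>)) (at 0)"
    by (rule has_derivative_imp_has_field_derivative) simp
  then have d: "((\<lambda>t. (x0 - t *\<^sub>R \<nu>) \<bullet> e - \<gamma> (x0 - t *\<^sub>R \<nu>)) has_real_derivative - (\<nu> \<bullet> N)) (at 0)"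
    by (auto intro!: derivative_eq_intros simp: inner_diff_left N_def inner_diff_right inner_commute)
  have "0 \<le> - (\<nu> \<bullet> N)"
  proof (rule ccontr)
    assume "\<not> ?thesis"
    then obtain \<epsilon> where \<epsilon>: "\<epsilon> > 0"
      "\<And>t. 0 < t \<Longrightarrow> t < \<epsilon> \<Longrightarrow> (x0 - t *\<^sub>R \<nu>) \<bullet> e - \<gamma> (x0 - t *\<^sub>R \<nu>) < 0"
      using DERIV_neg_dec_right[OF d] x0 by force
    have "\<forall>\<^sub>F t in at_right 0. x0 - t *\<^sub>R \<nu> \<in> S"
      using normal by (auto simp: outward_unit_normal_def elim: eventually_mono)
    then obtain \<epsilon>' where \<epsilon>': "\<epsilon>' > 0" "\<And>t. 0 < t \<Longrightarrow> t < \<epsilon>' \<Longrightarrow> x0 - t *\<^sub>R \<nu> \<in> S"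
      by (auto simp: eventually_at_right_field)
    define t where "t = min r (min \<epsilon> \<epsilon>') / 2"
    have t: "0 < t" "t < r" "t < \<epsilon>" "t < \<epsilon>'" using r \<epsilon>(1) \<epsilon>'(1) by (auto simp: t_def)
    have "x0 - t *\<^sub>R \<nu> \<in> S \<inter> ball x0 r"
      using \<epsilon>'(2) t \<nu>1 by (auto simp: dist_norm)
    then show False using SB \<epsilon>(2)[of t] t by auto
  qed
  then have "\<kappa> * (N \<bullet> N) \<le> 0" by (simp add: \<nu>)
  moreover have "0 < N \<bullet> N" using Ne by auto
  ultimately have "\<kappa> \<le> 0" by (simp add: mult_le_0_iff)
  then have "- \<kappa> * norm N = 1" using \<nu>1 by (simp add: \<nu>)
  then have "- norm N *\<^sub>R \<nu> = N" by (simp add: \<nu> mult.commute flip: scaleR_minus_left)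
  then show "e - g = - norm (e - g) *\<^sub>R \<nu>" by (simp add: N_def)
qed

text \<open>
  A bounded Hessian makes the gradient Lipschitz, so along the segment from \<open>x0\<close> the gradient differs
  from its value at \<open>x0\<close> by at most \<open>K \<bar>x - x0\<bar>\<close>.
\<close>

lemma quadratic_upper_bound:
  fixes \<gamma> :: "real^'n \<Rightarrow> real"
  assumes \<gamma>: "C_upto 2 (ball x0 r) \<gamma>"
  obtains K where "0 \<le> K"
    "\<And>x. x \<in> ball x0 r \<Longrightarrow> \<gamma> x \<le> \<gamma> x0 + grad \<gamma> x0 \<bullet> (x - x0) + K * (norm (x - x0))\<^sup>2"
proof -
  obtain K where K: "0 \<le> K" "\<And>x h. x \<in> ball x0 r \<Longrightarrow> norm (hess \<gamma> x *v h) \<le> K * norm h"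
    using hess_bounded[OF \<gamma> open_ball bounded_ball] by metis
  have d: "(\<gamma> has_derivative (\<lambda>h. grad \<gamma> x \<bullet> h)) (at x)"
    "(grad \<gamma> has_derivative (\<lambda>h. hess \<gamma> x *v h)) (at x)" if "x \<in> ball x0 r" for x
    using C_upto_2_has_grad_hess_on[OF \<gamma> open_ball] that by (auto simp: has_grad_hess_on_def)
  have "\<gamma> x \<le> \<gamma> x0 + grad \<gamma> x0 \<bullet> (x - x0) + K * (norm (x - x0))\<^sup>2" if x: "x \<in> ball x0 r" for x
  proof -
    have x0: "x0 \<in> ball x0 r" using x by (auto intro: le_less_trans[OF zero_le_dist])
    let ?S = "closed_segment x0 x"
    have sub: "?S \<subseteq> ball x0 r" using x x0 by (intro closed_segment_subset) auto
    have lip: "norm (grad \<gamma> z - grad \<gamma> x0) \<le> K * norm (z - x0)" if "z \<in> ball x0 r" for z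
    proof (rule differentiable_bound[where S = "ball x0 r" and f' = "\<lambda>x h. hess \<gamma> x *v h"])
      show "(grad \<gamma> has_derivative (\<lambda>h. hess \<gamma> y *v h)) (at y within ball x0 r)"
        if "y \<in> ball x0 r" for y
        by (rule has_derivative_at_withinI[OF d(2)[OF that]])
      show "onorm (\<lambda>h. hess \<gamma> y *v h) \<le> K" if "y \<in> ball x0 r" for y
        using K(1) K(2)[OF that] by (rule onorm_bound)
    qed (use that x0 in auto)
    have "norm ((\<gamma> x - grad \<gamma> x0 \<bullet> x) - (\<gamma> x0 - grad \<gamma> x0 \<bullet> x0)) \<le> K * norm (x - x0) * norm (x - x0)"
    proof (rule differentiable_bound[where S = ?S and f' = "\<lambda>z h. (grad \<gamma> z - grad \<gamma> x0) \<bullet> h"])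
      fix z assume z: "z \<in> ?S"
      then have zb: "z \<in> ball x0 r" using sub by blast
      show "((\<lambda>x. \<gamma> x - grad \<gamma> x0 \<bullet> x) has_derivative (\<lambda>h. (grad \<gamma> z - grad \<gamma> x0) \<bullet> h)) (at z within ?S)"
        by (rule has_derivative_at_withinI)
          (rule has_derivative_eq_rhs[OF has_derivative_diff[OF d(1)[OF zb]
              has_derivative_inner_right[OF has_derivative_ident]]], simp add: inner_diff_left)
      have "norm (grad \<gamma> z - grad \<gamma> x0) \<le> K * norm (z - x0)" by (rule lip[OF zb])
      also have "\<dots> \<le> K * norm (x - x0)"
        using segment_bound1[OF z] K(1) by (intro mult_left_mono) auto
      finally have le: "norm (grad \<gamma> z - grad \<gamma> x0) \<le> K * norm (x - x0)" .
      show "onorm (\<lambda>h. (grad \<gamma> z - grad \<gamma> x0) \<bullet> h) \<le> K * norm (x - x0)"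
      proof (rule onorm_bound)
        show "norm ((grad \<gamma> z - grad \<gamma> x0) \<bullet> h) \<le> K * norm (x - x0) * norm h" for h
          using order_trans[OF Cauchy_Schwarz_ineq2 mult_right_mono[OF le norm_ge_zero]] by simp
      qed (use K(1) in auto)
    qed auto
    then have "(\<gamma> x - grad \<gamma> x0 \<bullet> x) - (\<gamma> x0 - grad \<gamma> x0 \<bullet> x0) \<le> K * (norm (x - x0) * norm (x - x0))"
      unfolding real_norm_def by (simp add: mult.assoc)
    then show ?thesis by (simp add: inner_diff_right power2_eq_square)
  qed
  with K(1) show thesis by (rule that)
qed

text \<open>
  With \<open>N = e - \<nabla>\<gamma>\<close>, a positive multiple of \<open>- \<nu>\<close>, a point \<open>x0 + d\<close> lies above the graph as soon as
  \<open>N \<bullet> d\<close> exceeds the quadratic error \<open>K \<bar>d\<bar>\<^sup>2\<close> of the first order expansion of \<open>\<gamma>\<close>. In the ball of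
  radius \<open>R\<close> touching at \<open>x0\<close> one has \<open>N \<bullet> d > \<bar>d\<bar>\<^sup>2 / (2 R)\<close>, because \<open>\<bar>N\<bar> \<ge> 1\<close>.
\<close>

lemma interior_ball:
  fixes S :: "(real^'n) set"
  assumes bd: "Holder_boundary 2 \<alpha> S" and S: "open S" "x0 \<in> frontier S"
    and normal: "outward_unit_normal S x0 \<nu>"
  obtains R where "0 < R" "ball (x0 - R *\<^sub>R \<nu>) R \<subseteq> S"
proof -
  obtain r e \<gamma> where chart: "graph_chart 2 \<alpha> S x0 r e \<gamma>"
    using bd S(2) by (auto simp: Holder_boundary_def)
  have r: "r > 0" and e: "norm e = 1" and SB: "S \<inter> ball x0 r = {x \<in> ball x0 r. \<gamma> x < x \<bullet> e}"
    and \<gamma>: "C_upto 2 (ball x0 r) \<gamma>"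
    using chart C_Holder_upto_imp_C_upto by (auto simp: graph_chart_def)
  have d\<gamma>: "(\<gamma> has_derivative (\<lambda>h. grad \<gamma> x0 \<bullet> h)) (at x0)"
    using C_upto_2_has_grad_hess_on[OF \<gamma> open_ball] r by (auto simp: has_grad_hess_on_def)
  have x0: "\<gamma> x0 = x0 \<bullet> e"
    by (rule frontier_mem_graph[OF chart S has_derivative_continuous[OF d\<gamma>]])
  define N where "N = e - grad \<gamma> x0"
  have N: "N = - norm N *\<^sub>R \<nu>"
    using graph_chart_normal(2)[OF chart x0 d\<gamma> normal] by (simp add: N_def)
  have "N \<bullet> e = 1"
    using graph_chart_normal(1)[OF chart x0 d\<gamma> normal] e by (simp add: N_def inner_diff_left norm_eq_1)
  then have N1: "1 \<le> norm N" using norm_cauchy_schwarz[of N e] e by simp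
  obtain K where K: "0 \<le> K"
    "\<And>x. x \<in> ball x0 r \<Longrightarrow> \<gamma> x \<le> \<gamma> x0 + grad \<gamma> x0 \<bullet> (x - x0) + K * (norm (x - x0))\<^sup>2"
    using quadratic_upper_bound[OF \<gamma>] by metis
  \<comment> \<open>the first bound keeps the ball inside the chart, the second one makes \<open>1 / (2 R)\<close> exceed \<open>K\<close>\<close>
  define R where "R = min (r / 2) (1 / (2 * K + 2))"
  have R: "0 < R" "2 * R \<le> r" "2 * R * K < 1"
  proof -
    show "0 < R" "2 * R \<le> r" using r K(1) by (auto simp: R_def)
    have "2 * R * K \<le> 2 * (1 / (2 * K + 2)) * K"
      using K(1) by (intro mult_right_mono mult_left_mono) (auto simp: R_def)
    also have "\<dots> < 1" using K(1) by (simp add: field_simps)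
    finally show "2 * R * K < 1" .
  qed
  have \<nu>1: "norm \<nu> = 1" using normal by (simp add: outward_unit_normal_def)
  have "ball (x0 - R *\<^sub>R \<nu>) R \<subseteq> S"
  proof
    fix x assume x: "x \<in> ball (x0 - R *\<^sub>R \<nu>) R"
    define d where "d = x - x0"
    have "norm (d + R *\<^sub>R \<nu>) < R"
      using x by (simp add: d_def dist_norm norm_minus_commute algebra_simps)
    then have "(norm (d + R *\<^sub>R \<nu>))\<^sup>2 < R\<^sup>2" using R(1) by (intro power_strict_mono) auto
    moreover have "(norm (d + R *\<^sub>R \<nu>))\<^sup>2 = (norm d)\<^sup>2 + 2 * R * (d \<bullet> \<nu>) + R\<^sup>2 * (\<nu> \<bullet> \<nu>)"
      unfolding power2_norm_eq_inner
      by (simp add: inner_add_left inner_add_right inner_commute power2_eq_square algebra_simps)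
    ultimately have *: "(norm d)\<^sup>2 < 2 * R * - (d \<bullet> \<nu>)"
      using \<nu>1 by (simp add: norm_eq_1)
    have nn: "0 < - (d \<bullet> \<nu>)"
      by (rule zero_less_mult_pos[of "2 * R"]) (use * R(1) zero_le_power2[of "norm d"] in linarith)+
    have "K * (norm d)\<^sup>2 \<le> K * (2 * R * - (d \<bullet> \<nu>))" using * K(1) by (intro mult_left_mono) auto
    also have "\<dots> = (2 * R * K) * - (d \<bullet> \<nu>)" by simp
    also have "\<dots> < 1 * - (d \<bullet> \<nu>)" using R(3) nn by (rule mult_strict_right_mono)
    also have "\<dots> \<le> norm N * - (d \<bullet> \<nu>)" using N1 nn by (intro mult_right_mono) auto
    also have "\<dots> = N \<bullet> d" by (subst (2) N) (simp add: inner_commute)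
    finally have strict: "K * (norm d)\<^sup>2 < N \<bullet> d" .
    have "dist x0 x < r"
    proof -
      have "dist x0 (x0 - R *\<^sub>R \<nu>) = R" using R(1) \<nu>1 by (simp add: dist_norm)
      then show ?thesis using dist_triangle[of x0 x "x0 - R *\<^sub>R \<nu>"] x R(2) by simp
    qed
    then have xb: "x \<in> ball x0 r" by simp
    have "\<gamma> x \<le> \<gamma> x0 + grad \<gamma> x0 \<bullet> d + K * (norm d)\<^sup>2" using K(2)[OF xb] by (simp add: d_def)
    also have "\<dots> < x0 \<bullet> e + grad \<gamma> x0 \<bullet> d + N \<bullet> d" using strict x0 by simp
    also have "\<dots> = x \<bullet> e" by (simp add: N_def d_def inner_diff_left inner_diff_right inner_commute)
    finally show "x \<in> S" using xb SB by auto
  qed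
  with R(1) show thesis by (rule that)
qed

section \<open>Comparison of conormal derivatives\<close>

lemma C_upto_Suc_lipschitz_on_interval:
  fixes F :: "real \<Rightarrow> real"
  assumes "C_upto (Suc k) UNIV F"
  obtains C where "\<And>s t. s \<in> {a..b} \<Longrightarrow> t \<in> {a..b} \<Longrightarrow> \<bar>F s - F t\<bar> \<le> C * \<bar>s - t\<bar>"
proof -
  have "bounded_C1_on {a..b} F"
    by (rule C_upto_imp_bounded_C1_on[OF assms]) auto
  then obtain C where "\<forall>x\<in>{a..b}. \<bar>F x\<bar> \<le> C \<and> F differentiable at x
      \<and> (\<forall>b\<in>Basis. \<bar>partial_deriv b F x\<bar> \<le> C)"
    unfolding bounded_C1_on_def by blast
  then have C: "F differentiable at x" "\<bar>partial_deriv 1 F x\<bar> \<le> C" if "x \<in> {a..b}" for x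
    using that by auto
  have D: "(F has_field_derivative partial_deriv 1 F x) (at x within {a..b})" if x: "x \<in> {a..b}" for x
  proof -
    obtain D where D: "(F has_derivative D) (at x)" using C(1)[OF x] by (auto simp: differentiable_def)
    have "h * partial_deriv 1 F x = D h" for h
      using linear_scale[OF has_derivative_linear[OF D], of h 1] by (simp add: partial_deriv_eq[OF D])
    then have "(F has_field_derivative partial_deriv 1 F x) (at x)"
      by (rule has_derivative_imp_has_field_derivative[OF D])
    then show ?thesis by (rule has_field_derivative_at_within)
  qed
  have "\<bar>F s - F t\<bar> \<le> C * \<bar>s - t\<bar>" if "s \<in> {a..b}" "t \<in> {a..b}" for s t
  proof -
    have "norm (F s - F t) \<le> C * norm (s - t)"
    proof (rule field_differentiable_bound[OF _ D])
      show "norm (partial_deriv 1 F x) \<le> C" if "x \<in> {a..b}" for x using C(2)[OF that] by simp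
    qed (use that in simp_all)
    then show ?thesis by simp
  qed
  then show thesis by (rule that)
qed

text \<open>
  The conormal derivative is the boundary value of the derivative in the direction \<open>\<nu> a\<close>, which is
  the form in which Hopf's lemma is applied.
\<close>

lemma conormal_deriv_limit:
  assumes v: "C_upto (Suc k) \<Omega> v" and \<Omega>: "open \<Omega>" "x0 \<in> frontier \<Omega>"
  shows "((\<lambda>x. grad v x \<bullet> (\<nu> x0 v* a x0)) \<longlongrightarrow> conormal_deriv \<Omega> a \<nu> v x0) (at x0 within \<Omega>)"
proof -
  have x0: "x0 \<in> closure \<Omega>" "x0 \<notin> \<Omega>" using \<Omega> by (auto simp: frontier_def interior_open)
  then have nbot: "at x0 within \<Omega> \<noteq> bot"
    by (metis closure_def trivial_limit_within Un_iff mem_Collect_eq)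
  have lim: "(partial_deriv (axis j 1) v \<longlongrightarrow> Lim (at x0 within \<Omega>) (partial_deriv (axis j 1) v))
      (at x0 within \<Omega>)" for j
  proof -
    obtain l where l: "(partial_deriv (axis j 1) v \<longlongrightarrow> l) (at x0 within \<Omega>)"
      by (rule C_upto_partial_deriv_limit[OF v axis_Basis x0(1)]) (rule that)
    then show ?thesis using tendsto_Lim[OF nbot l] by simp
  qed
  have "((\<lambda>x. \<Sum>j\<in>UNIV. partial_deriv (axis j 1) v x * (\<nu> x0 v* a x0) $ j)
      \<longlongrightarrow> (\<Sum>j\<in>UNIV. Lim (at x0 within \<Omega>) (partial_deriv (axis j 1) v) * (\<nu> x0 v* a x0) $ j))
      (at x0 within \<Omega>)"
    by (intro tendsto_intros lim)
  moreover have "(\<Sum>j\<in>UNIV. Lim (at x0 within \<Omega>) (partial_deriv (axis j 1) v) * (\<nu> x0 v* a x0) $ j)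
      = conormal_deriv \<Omega> a \<nu> v x0"
    unfolding conormal_deriv_def vector_matrix_mult_def
    by (subst sum.swap) (simp add: sum_distrib_left mult_ac)
  ultimately show ?thesis by (simp add: grad_def inner_vec_def)
qed

text \<open>
  The conormal direction \<open>\<nu> a\<close> points outwards by ellipticity, so Hopf's lemma applies to the
  difference of the solutions, which is positive in the domain and zero on the boundary.
\<close>

lemma conormal_deriv_strict_comparison:
  fixes \<Omega> :: "(real^'n) set"
  assumes domain: "open \<Omega>" "connected \<Omega>" "bounded \<Omega>" "Holder_boundary 2 \<alpha> \<Omega>"
    and a_C1: "\<And>i j. C_upto (Suc k) \<Omega> (\<lambda>x. a x $ i $ j)"
    and a_sym: "\<And>x i j. x \<in> closure \<Omega> \<Longrightarrow> a x $ i $ j = a x $ j $ i"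
    and a_ell: "elliptic_on (closure \<Omega>) a"
    and F1: "antimono F1" "F1 0 = 0"
    and F2: "antimono F2" "F2 0 = 0" "C_upto (Suc k') UNIV F2"
    and less: "\<And>s. s \<in> {0<..d} \<Longrightarrow> F2 s < F1 s"
    and u1: "solves_bvp \<alpha> \<Omega> a F1 \<phi> u1" and u2: "solves_bvp \<alpha> \<Omega> a F2 \<phi> u2"
    and \<phi>: "\<And>x. x \<in> frontier \<Omega> \<Longrightarrow> \<phi> x \<in> {0..d}" and q: "q \<in> frontier \<Omega>" "0 < \<phi> q"
    and x0: "x0 \<in> frontier \<Omega>" and normal: "outward_unit_normal \<Omega> x0 (\<nu> x0)"
  shows "conormal_deriv \<Omega> a \<nu> u1 x0 < conormal_deriv \<Omega> a \<nu> u2 x0"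
proof -
  obtain c where c: "c > 0" "\<And>x \<xi>. x \<in> closure \<Omega> \<Longrightarrow> c * (norm \<xi>)\<^sup>2 \<le> \<xi> \<bullet> (a x *v \<xi>)"
    by (rule elliptic_onE[OF a_ell]) (rule that)
  obtain \<Lambda> where \<Lambda>: "\<And>x. x \<in> \<Omega> \<Longrightarrow> det (a x) \<noteq> 0"
    "\<And>x i k. x \<in> \<Omega> \<Longrightarrow> flux_coeff a i k differentiable at x"
    "\<And>x. x \<in> \<Omega> \<Longrightarrow> trace (a x) \<le> \<Lambda>" "\<And>x. x \<in> \<Omega> \<Longrightarrow> norm (drift a x) \<le> \<Lambda>"
    by (rule elliptic_coefficients_bounded[OF domain(3) a_C1 a_ell]) (rule that)
  have cl: "x \<in> closure \<Omega>" if "x \<in> \<Omega>" for x using that closure_subset by blast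
  interpret elliptic_operator \<Omega> a "drift a" c \<Lambda>
    by unfold_locales (use domain(1) c \<Lambda> a_sym cl in \<open>auto simp: vec_eq_iff transpose_def\<close>)
  have reg: "C_upto 2 \<Omega> u" "continuous_on (closure \<Omega>) u" "has_grad_hess_on u (grad u) (hess u) \<Omega>"
    "\<And>x. x \<in> \<Omega> \<Longrightarrow> L (grad u) (hess u) x = - F (u x)" "\<And>x. x \<in> frontier \<Omega> \<Longrightarrow> u x = \<phi> x"
    if u: "solves_bvp \<alpha> \<Omega> a F \<phi> u" for F u
  proof -
    show C2: "C_upto 2 \<Omega> u" using u C_Holder_upto_imp_C_upto by (auto simp: solves_bvp_def)
    show "continuous_on (closure \<Omega>) u" by (rule C_upto_imp_continuous_on[OF C2])
    show "has_grad_hess_on u (grad u) (hess u) \<Omega>" by (rule C_upto_2_has_grad_hess_on[OF C2 domain(1)])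
    show "L (grad u) (hess u) x = - F (u x)" if x: "x \<in> \<Omega>" for x
      using div_op_nondivergence[OF C2 domain(1) x \<Lambda>(1)[OF x] \<Lambda>(2)[OF x]] u x
      by (simp add: solves_bvp_def L_def)
    show "u x = \<phi> x" if "x \<in> frontier \<Omega>" for x using u that by (simp add: solves_bvp_def)
  qed
  note reg1 = reg[OF u1] and reg2 = reg[OF u2]
  obtain C where C: "\<And>s t. s \<in> {0..d} \<Longrightarrow> t \<in> {0..d} \<Longrightarrow> \<bar>F2 s - F2 t\<bar> \<le> C * \<bar>s - t\<bar>"
    by (rule C_upto_Suc_lipschitz_on_interval[OF F2(3)]) (rule that)
  have eq: "u1 x = u2 x" "u1 x \<in> {0..d}" if "x \<in> frontier \<Omega>" for x
    using that reg1(5) reg2(5) \<phi> by auto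
  have q1: "0 < u1 q" using q reg1(5) by simp
  have cmp: "x \<in> closure \<Omega> \<Longrightarrow> u2 x \<le> u1 x" "x \<in> \<Omega> \<Longrightarrow> u2 x < u1 x"
    "x \<in> \<Omega> \<Longrightarrow> L (\<lambda>x. grad u1 x - 1 *\<^sub>R grad u2 x) (\<lambda>x. hess u1 x - 1 *\<^sub>R hess u2 x) x
      \<le> C * (u1 x - u2 x)" for x
    by (rule semilinear_comparison[OF domain(3,2) reg1(2-4) reg2(2-4) F1 F2(1,2) C less eq q(1) q1],
        assumption+)+
  obtain R where R: "0 < R" "ball (x0 - R *\<^sub>R \<nu> x0) R \<subseteq> \<Omega>"
    by (rule interior_ball[OF domain(4,1) x0 normal]) (rule that)
  have \<nu>: "norm (\<nu> x0) = 1" using normal by (simp add: outward_unit_normal_def)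
  have x0c: "x0 \<in> closure \<Omega>" using x0 by (simp add: frontier_def)
  have "conormal_deriv \<Omega> a \<nu> u1 x0 - conormal_deriv \<Omega> a \<nu> u2 x0 < 0"
  proof (rule hopf_boundary_point[OF R \<nu>])
    show "0 \<le> \<bar>C\<bar>" by simp
    show "continuous_on (closure \<Omega>) (\<lambda>x. u1 x - 1 * u2 x)"
      by (intro continuous_intros reg1 reg2)
    show "has_grad_hess_on (\<lambda>x. u1 x - 1 * u2 x) (\<lambda>x. grad u1 x - 1 *\<^sub>R grad u2 x)
        (\<lambda>x. hess u1 x - 1 *\<^sub>R hess u2 x) \<Omega>"
      by (rule has_grad_hess_on_diff_scaled[OF reg1(3) reg2(3)])
    show "0 \<le> u1 x - 1 * u2 x" if "x \<in> closure \<Omega>" for x using cmp(1)[OF that] by simp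
    show "0 < u1 x - 1 * u2 x" if "x \<in> \<Omega>" for x using cmp(2)[OF that] by simp
    show "L (\<lambda>x. grad u1 x - 1 *\<^sub>R grad u2 x) (\<lambda>x. hess u1 x - 1 *\<^sub>R hess u2 x) x
        \<le> \<bar>C\<bar> * (u1 x - 1 * u2 x)" if x: "x \<in> \<Omega>" for x
    proof -
      have "C * (u1 x - u2 x) \<le> \<bar>C\<bar> * (u1 x - u2 x)"
        using cmp(2)[OF x] by (intro mult_right_mono) auto
      then show ?thesis using cmp(3)[OF x] by simp
    qed
    show "u1 x0 - 1 * u2 x0 = 0" using eq(1)[OF x0] by simp
    have "(\<nu> x0 v* a x0) \<bullet> \<nu> x0 = \<nu> x0 \<bullet> (a x0 *v \<nu> x0)"
      by (simp add: dot_lmul_matrix)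
    then show "0 < (\<nu> x0 v* a x0) \<bullet> \<nu> x0"
      using c(2)[OF x0c, of "\<nu> x0"] c(1) \<nu> by simp
    have "((\<lambda>x. grad u1 x \<bullet> (\<nu> x0 v* a x0) - grad u2 x \<bullet> (\<nu> x0 v* a x0))
        \<longlongrightarrow> conormal_deriv \<Omega> a \<nu> u1 x0 - conormal_deriv \<Omega> a \<nu> u2 x0) (at x0 within \<Omega>)"
      using reg1(1) reg2(1) unfolding numeral_2_eq_2
      by (intro tendsto_diff conormal_deriv_limit[OF _ domain(1) x0])
    then show "((\<lambda>x. (grad u1 x - 1 *\<^sub>R grad u2 x) \<bullet> (\<nu> x0 v* a x0))
        \<longlongrightarrow> conormal_deriv \<Omega> a \<nu> u1 x0 - conormal_deriv \<Omega> a \<nu> u2 x0) (at x0 within \<Omega>)"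
      by (simp add: inner_diff_left)
  qed
  then show ?thesis by simp
qed

section \<open>Ordering of the nonlinearities and conclusion\<close>

text \<open>
  The quotient \<open>s ^ l' / s ^ l\<close> is at most \<open>s\<close>, hence at most \<open>d\<close>.
\<close>

lemma monomial_abs_less:
  fixes b b' d s :: real
  assumes b: "b \<noteq> 0" and d: "d \<le> 1" "d * \<bar>b'\<bar> < \<bar>b\<bar>" and s: "0 < s" "s \<le> d" and l: "l < l'"
  shows "\<bar>b'\<bar> * s ^ l' < \<bar>b\<bar> * s ^ l"
proof -
  obtain j where j: "l' = l + Suc j" using l by (metis less_natE add_Suc_right)
  have "\<bar>b'\<bar> * s ^ Suc j \<le> \<bar>b'\<bar> * s"
    using s d mult_left_le[of "s ^ j" s] power_le_one[of s j] by (intro mult_left_mono) auto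
  also have "\<dots> \<le> \<bar>b'\<bar> * d" using s by (intro mult_left_mono) auto
  also have "\<dots> < \<bar>b\<bar>" using d by (simp add: mult.commute)
  finally have "(\<bar>b'\<bar> * s ^ Suc j) * s ^ l < \<bar>b\<bar> * s ^ l"
    using s by (intro mult_strict_right_mono) auto
  then show ?thesis by (simp add: j power_add mult_ac)
qed

text \<open>
  On \<open>[0, 1]\<close> both functions are nonpositive, so the ordering is the reverse of that of their absolute
  values \<open>\<bar>b\<bar> s ^ l \<bar>h s\<bar>\<close>. If the exponents agree, the coefficients decide; otherwise the larger
  exponent gives the smaller absolute value on \<open>(0, d]\<close>.
\<close>

lemma nonlinearities_ordered:
  fixes b1 b2 d :: real
  assumes h: "\<And>s. s \<in> {0..1} \<Longrightarrow> h s \<noteq> 0"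
    and F1: "antimono F1" "F1 0 = 0" "\<And>s. F1 s = b1 * s ^ l1 * h s"
    and F2: "antimono F2" "F2 0 = 0" "\<And>s. F2 s = b2 * s ^ l2 * h s"
    and b: "b1 \<noteq> 0" "b2 \<noteq> 0"
    and d: "d \<le> 1" "d * \<bar>b1\<bar> < \<bar>b2\<bar>" "d * \<bar>b2\<bar> < \<bar>b1\<bar>"
  shows "F1 = F2 \<or> (\<forall>s\<in>{0<..d}. F2 s < F1 s) \<or> (\<forall>s\<in>{0<..d}. F1 s < F2 s)"
proof -
  have neg: "F s = - (\<bar>b\<bar> * s ^ l * \<bar>h s\<bar>)"
    if "antimono F" "F 0 = 0" "F s = b * s ^ l * h s" "s \<in> {0<..d}" for F b s and l :: nat
  proof -
    have "F s \<le> 0" using antimonoD[OF that(1), of 0 s] that(2,4) by simp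
    moreover have "\<bar>F s\<bar> = \<bar>b\<bar> * s ^ l * \<bar>h s\<bar>" using that(3,4) by (simp add: abs_mult)
    ultimately show ?thesis by simp
  qed
  have less: "F s < F' s"
    if "\<bar>b'\<bar> * s ^ l' < \<bar>b\<bar> * s ^ l" "F s = - (\<bar>b\<bar> * s ^ l * \<bar>h s\<bar>)"
      "F' s = - (\<bar>b'\<bar> * s ^ l' * \<bar>h s\<bar>)" "s \<in> {0<..d}"
    for F F' :: "real \<Rightarrow> real" and b b' s and l l' :: nat
    using that h[of s] d(1) by simp
  note N1 = neg[OF F1] and N2 = neg[OF F2]
  consider "l1 = l2" "b1 = b2" | "l1 = l2" "\<bar>b1\<bar> = \<bar>b2\<bar>" "b1 \<noteq> b2" | "l1 = l2" "\<bar>b1\<bar> < \<bar>b2\<bar>"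
    | "l1 = l2" "\<bar>b2\<bar> < \<bar>b1\<bar>" | "l1 < l2" | "l2 < l1" by linarith
  then show ?thesis
  proof cases
    case 1
    then have "F1 = F2" using F1(3) F2(3) by auto
    then show ?thesis ..
  next
    case 2
    \<comment> \<open>opposite signs are impossible, since both functions are nonpositive at \<open>1\<close>, where \<open>h\<close> has no zero\<close>
    then have "b2 = - b1" by linarith
    then have "F2 1 = - F1 1" using F1(3)[of 1] F2(3)[of 1] by simp
    moreover have "F1 1 \<le> 0" "F2 1 \<le> 0"
      using antimonoD[OF F1(1), of 0 1] antimonoD[OF F2(1), of 0 1] F1(2) F2(2) by auto
    ultimately have "F1 1 = 0" by linarith
    then show ?thesis using F1(3)[of 1] b h[of 1] by simp
  next
    case 3
    then have "\<forall>s\<in>{0<..d}. F2 s < F1 s" by (intro ballI less[OF _ N2 N1]) auto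
    then show ?thesis by blast
  next
    case 4
    then have "\<forall>s\<in>{0<..d}. F1 s < F2 s" by (intro ballI less[OF _ N1 N2]) auto
    then show ?thesis by blast
  next
    case 5
    then have "\<forall>s\<in>{0<..d}. F1 s < F2 s"
      by (intro ballI less[OF monomial_abs_less[OF b(1) d(1,3)] N1 N2]) auto
    then show ?thesis by blast
  next
    case 6
    then have "\<forall>s\<in>{0<..d}. F2 s < F1 s"
      by (intro ballI less[OF monomial_abs_less[OF b(2) d(1,2)] N2 N1]) auto
    then show ?thesis by blast
  qed
qed

theorem corollary2p3:
  fixes \<Omega> :: "(real^'n) set"
    and a :: "real^'n \<Rightarrow> real^'n^'n"
    and \<nu> :: "real^'n \<Rightarrow> real^'n"
    and g u1 u2 :: "real^'n \<Rightarrow> real"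
    and F1 F2 h :: "real \<Rightarrow> real"
    and \<alpha> b1 b2 m M \<delta> :: real
    and l1 l2 :: nat
    and x0 :: "real^'n"
  assumes dim: "CARD('n) \<ge> 2"
    and alpha: "0 < \<alpha>" "\<alpha> < 1"
    and domain: "open \<Omega>" "connected \<Omega>" "bounded \<Omega>" "Holder_boundary 2 \<alpha> \<Omega>"
    and normal: "\<And>x. x \<in> frontier \<Omega> \<Longrightarrow> outward_unit_normal \<Omega> x (\<nu> x)"
    and a_C2: "\<And>i j. C_upto 2 \<Omega> (\<lambda>x. a x $ i $ j)"
    and a_sym: "\<And>x i j. x \<in> closure \<Omega> \<Longrightarrow> a x $ i $ j = a x $ j $ i"
    and a_ell: "elliptic_on (closure \<Omega>) a"
    and g_reg: "C_Holder_boundary 2 \<alpha> \<Omega> g"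
    and g_range: "g ` frontier \<Omega> = {0..1}"
    and h_C2: "C_upto 2 UNIV h"
    and h_nz: "\<And>s. s \<in> {0..1} \<Longrightarrow> h s \<noteq> 0"
    and F1: "C_upto 2 UNIV F1" "antimono F1" "F1 0 = 0" "\<And>s. F1 s = b1 * s ^ l1 * h s"
    and F2: "C_upto 2 UNIV F2" "antimono F2" "F2 0 = 0" "\<And>s. F2 s = b2 * s ^ l2 * h s"
    and m: "min \<bar>b1\<bar> \<bar>b2\<bar> = m" "m > 0"
    and M: "max \<bar>b1\<bar> \<bar>b2\<bar> = M"
    and delta: "\<delta> \<in> {0<..<m / M}"
    and u1: "solves_bvp \<alpha> \<Omega> a F1 (\<lambda>x. \<delta> * g x) u1"
    and u2: "solves_bvp \<alpha> \<Omega> a F2 (\<lambda>x. \<delta> * g x) u2"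
    and x0: "x0 \<in> frontier \<Omega>"
    and flux: "conormal_deriv \<Omega> a \<nu> u1 x0 = conormal_deriv \<Omega> a \<nu> u2 x0"
  shows "F1 = F2"
proof -
  have b: "b1 \<noteq> 0" "b2 \<noteq> 0" and M0: "0 < M" using m M by auto
  have "\<delta> * M < m" using delta M0 by (simp add: pos_less_divide_eq)
  moreover have "m \<le> M" using m M by auto
  ultimately have \<delta>: "0 < \<delta>" "\<delta> * M < m" "\<delta> * M < 1 * M" using delta by auto
  have \<delta>1: "\<delta> \<le> 1" using \<delta>(3) M0 by simp
  have "\<delta> * \<bar>b1\<bar> \<le> \<delta> * M" "\<delta> * \<bar>b2\<bar> \<le> \<delta> * M"
    using \<delta>(1) M by (auto intro!: mult_left_mono)
  then have bs: "\<delta> * \<bar>b1\<bar> < \<bar>b2\<bar>" "\<delta> * \<bar>b2\<bar> < \<bar>b1\<bar>" using \<delta>(2) m(1) by auto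
  have \<phi>: "\<delta> * g x \<in> {0..\<delta>}" if "x \<in> frontier \<Omega>" for x
  proof -
    have "g x \<in> {0..1}" using g_range that by blast
    then show ?thesis using \<delta>(1) by (simp add: mult_left_le)
  qed
  have "1 \<in> g ` frontier \<Omega>" using g_range by simp
  then obtain q where q: "q \<in> frontier \<Omega>" "g q = 1" by force
  have q0: "0 < \<delta> * g q" using q(2) \<delta>(1) by simp
  have "F1 = F2 \<or> (\<forall>s\<in>{0<..\<delta>}. F2 s < F1 s) \<or> (\<forall>s\<in>{0<..\<delta>}. F1 s < F2 s)"
    by (rule nonlinearities_ordered[OF h_nz F1(2-4) F2(2-4) b \<delta>1 bs])
  then show "F1 = F2"
  proof (elim disjE)
    assume "\<forall>s\<in>{0<..\<delta>}. F2 s < F1 s"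
    then have less: "F2 s < F1 s" if "s \<in> {0<..\<delta>}" for s using that by blast
    have "conormal_deriv \<Omega> a \<nu> u1 x0 < conormal_deriv \<Omega> a \<nu> u2 x0"
      by (rule conormal_deriv_strict_comparison[where a = a and \<nu> = \<nu> and
            \<phi> = "\<lambda>x. \<delta> * g x", OF domain a_C2[unfolded numeral_2_eq_2] a_sym a_ell
            F1(2,3) F2(2,3) F2(1)[unfolded numeral_2_eq_2] less u1 u2 \<phi> q(1) q0 x0
            normal[OF x0]]) assumption+
    with flux show ?thesis by simp
  next
    assume "\<forall>s\<in>{0<..\<delta>}. F1 s < F2 s"
    then have less: "F1 s < F2 s" if "s \<in> {0<..\<delta>}" for s using that by blast
    have "conormal_deriv \<Omega> a \<nu> u2 x0 < conormal_deriv \<Omega> a \<nu> u1 x0"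
      by (rule conormal_deriv_strict_comparison[where a = a and \<nu> = \<nu> and
            \<phi> = "\<lambda>x. \<delta> * g x", OF domain a_C2[unfolded numeral_2_eq_2] a_sym a_ell
            F2(2,3) F1(2,3) F1(1)[unfolded numeral_2_eq_2] less u2 u1 \<phi> q(1) q0 x0
            normal[OF x0]]) assumption+
    with flux show ?thesis by simp
  qed
qed

end
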